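(* Let $S,K\subset\mathbb{R}$ be nonempty open bounded intervals, let $h>0$ and $M\ge 0$, and let $\mathbf{e}\in L^2(S,\mathbb{R}^2)$ with $\mathbf{e}\notin b_2^*[W_0^{1,2}(K)]$. Let $\phi_o\in W_0^{1,2}(K)$ be the unique minimizer of $\|b_2^*[\phi]-\mathbf{e}\|_{L^2(S,\mathbb{R}^2)}$ over all $\phi\in W_0^{1,2}(K)$ with $\|\phi\|_{W_0^{1,2}(K)}\le M$. Then there exists $\gamma<0$ such that $$b_2\,b_2^*[\phi_o]+\gamma\,\phi_o''=b_2[\mathbf{e}]$$ in the weak sense on $K$, that is, $\langle b_2b_2^*[\phi_o],\psi\rangle_{L^2(K)}-\langle b_2[\mathbf{e}],\psi\rangle_{L^2(K)}=\gamma\,\langle\phi_o',\psi'\rangle_{L^2(K)}$ for all $\psi\in W_0^{1,2}(K)$; and $\|\phi_o\|_{W_0^{1,2}(K)}=\|\phi_o'\|_{L^2(K)}=M$.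
   Context: All $L^2(K)$ functions are real-valued, and $L^2(S,\mathbb{R}^2)$ carries the inner product $\langle (f_1,f_2),(g_1,g_2)\rangle=\langle f_1,g_1\rangle_{L^2(S)}+\langle f_2,g_2\rangle_{L^2(S)}$. $W_0^{1,2}(K)$ is the space of real-valued $\phi\in L^2(K)$ with distributional derivative $\phi'\in L^2(K)$ and $\phi=0$ at the endpoints of $K$, equipped with the norm $\|\phi\|_{W_0^{1,2}(K)}=\|\phi'\|_{L^2(K)}$. For a bounded interval $I$ and $f\in L^2(I)$, $\widetilde f\in L^2(\mathbb{R})$ denotes the extension of $f$ by $0$ outside $I$. For $y>0$, $x\in\mathbb{R}$, $P_y(x)=\frac{1}{\pi}\frac{y}{x^2+y^2}$ and $Q_y(x)=\frac{1}{\pi}\frac{x}{x^2+y^2}$; $\star$ is convolution in $x\in\mathbb{R}$. The bounded operator $b_2:L^2(S,\mathbb{R}^2)\to L^2(K)$ is $b_2[(m_1,m_2)]=-\left[\partial_x\left(P_h\star\widetilde{m_1}-Q_h\star\widetilde{m_2}\right)\right]_{|K}$, and its adjoint is $b_2^*:L^2(K)\to L^2(S,\mathbb{R}^2)$, $b_2^*[\phi]=\left(\partial_x(P_h\star\widetilde\phi)_{|S},\ \partial_x(Q_h\star\widetilde\phi)_{|S}\right)$; it is applied to $\phi_o\in W_0^{1,2}(K)\subset L^2(K)$. The minimizer $\phi_o$ exists and is unique.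
   Formalization: The weak equation with γ<0 is claimed only for M>0: for M=0 the minimizer is 0 and the equation would force b_2[e]=0, hence e=0 by injectivity of b_2, contradicting e∉b_2^*[W_0^{1,2}(K)]; the norm equality is kept for all M≥0. *)

theory Defs
  imports "HOL-Analysis.Analysis"
begin

text \<open>Elements of \<open>L\<^sup>2(A)\<close> are represented by functions on the whole line: values
  outside \<open>A\<close> are irrelevant, equality is \<open>eq_ae A\<close>. Every class has a Borel
  representative, so measurability is taken with respect to \<^term>\<open>lborel\<close>.\<close>

definition L2 :: "real set \<Rightarrow> (real \<Rightarrow> real) set" where
  "L2 A = {f. set_borel_measurable lborel A f \<and> set_integrable lborel A (\<lambda>x. (f x)\<^sup>2)}"

definition eq_ae :: "real set \<Rightarrow> (real \<Rightarrow> real) \<Rightarrow> (real \<Rightarrow> real) \<Rightarrow> bool" where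
  "eq_ae A f g \<longleftrightarrow> (AE x in lborel. x \<in> A \<longrightarrow> f x = g x)"

definition L2_inner :: "real set \<Rightarrow> (real \<Rightarrow> real) \<Rightarrow> (real \<Rightarrow> real) \<Rightarrow> real" where
  "L2_inner A f g = (LINT x:A|lborel. f x * g x)"

definition L2_norm :: "real set \<Rightarrow> (real \<Rightarrow> real) \<Rightarrow> real" where
  "L2_norm A f = sqrt (L2_inner A f f)"

type_synonym field2 = "(real \<Rightarrow> real) \<times> (real \<Rightarrow> real)"

definition L2v :: "real set \<Rightarrow> field2 set" where
  "L2v A = L2 A \<times> L2 A"

definition eq_aev :: "real set \<Rightarrow> field2 \<Rightarrow> field2 \<Rightarrow> bool" where
  "eq_aev A f g \<longleftrightarrow> eq_ae A (fst f) (fst g) \<and> eq_ae A (snd f) (snd g)"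

definition L2v_inner :: "real set \<Rightarrow> field2 \<Rightarrow> field2 \<Rightarrow> real" where
  "L2v_inner A f g = L2_inner A (fst f) (fst g) + L2_inner A (snd f) (snd g)"

definition L2v_norm :: "real set \<Rightarrow> field2 \<Rightarrow> real" where
  "L2v_norm A f = sqrt (L2v_inner A f f)"

definition diffv :: "field2 \<Rightarrow> field2 \<Rightarrow> field2" where
  "diffv f g = ((\<lambda>x. fst f x - fst g x), (\<lambda>x. snd f x - snd g x))"

text \<open>\<open>C\<^sub>c\<^sup>\<infinity>(K)\<close>, extended by 0 to the line.\<close>

definition test_functions :: "real set \<Rightarrow> (real \<Rightarrow> real) set" where
  "test_functions K = {\<eta>. (\<forall>n x. ((deriv ^^ n) \<eta>) differentiable (at x)) \<and>
     (\<exists>C. compact C \<and> C \<subseteq> K \<and> (\<forall>x. x \<notin> C \<longrightarrow> \<eta> x = 0))}"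

definition has_weak_deriv :: "real set \<Rightarrow> (real \<Rightarrow> real) \<Rightarrow> (real \<Rightarrow> real) \<Rightarrow> bool" where
  "has_weak_deriv K \<phi> g \<longleftrightarrow>
     (\<forall>\<eta> \<in> test_functions K. L2_inner K \<phi> (deriv \<eta>) = - L2_inner K g \<eta>)"

text \<open>The boundary condition refers to the continuous representative on the closed interval.\<close>

definition W012 :: "real set \<Rightarrow> (real \<Rightarrow> real) set" where
  "W012 K = {\<phi> \<in> L2 K. (\<exists>g \<in> L2 K. has_weak_deriv K \<phi> g) \<and>
     (\<exists>u. continuous_on (closure K) u \<and> (\<forall>x \<in> frontier K. u x = 0) \<and> eq_ae K \<phi> u)}"

text \<open>The choice is unique up to \<open>eq_ae K\<close>.\<close>

definition weak_deriv :: "real set \<Rightarrow> (real \<Rightarrow> real) \<Rightarrow> (real \<Rightarrow> real)" where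
  "weak_deriv K \<phi> = (SOME g. g \<in> L2 K \<and> has_weak_deriv K \<phi> g)"

definition W012_norm :: "real set \<Rightarrow> (real \<Rightarrow> real) \<Rightarrow> real" where
  "W012_norm K \<phi> = L2_norm K (weak_deriv K \<phi>)"

definition ext0 :: "real set \<Rightarrow> (real \<Rightarrow> real) \<Rightarrow> (real \<Rightarrow> real)" where
  "ext0 A f = (\<lambda>x. if x \<in> A then f x else 0)"

definition poisson :: "real \<Rightarrow> real \<Rightarrow> real" where
  "poisson y x = 1 / pi * (y / (x\<^sup>2 + y\<^sup>2))"

definition conj_poisson :: "real \<Rightarrow> real \<Rightarrow> real" where
  "conj_poisson y x = 1 / pi * (x / (x\<^sup>2 + y\<^sup>2))"

definition convol :: "(real \<Rightarrow> real) \<Rightarrow> (real \<Rightarrow> real) \<Rightarrow> (real \<Rightarrow> real)" where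
  "convol f g = (\<lambda>x. LINT t|lborel. f (x - t) * g t)"

text \<open>The restrictions to \<open>K\<close> resp. \<open>S\<close> of the results are implicit in the representation
  of \<open>L\<^sup>2\<close>; for \<open>h > 0\<close> the convolutions are smooth, so \<^const>\<open>deriv\<close> is the
  classical derivative.\<close>

definition b2 :: "real set \<Rightarrow> real \<Rightarrow> field2 \<Rightarrow> (real \<Rightarrow> real)" where
  "b2 S h m = (\<lambda>x. - deriv (\<lambda>z. convol (poisson h) (ext0 S (fst m)) z
                               - convol (conj_poisson h) (ext0 S (snd m)) z) x)"

definition b2_adj :: "real set \<Rightarrow> real \<Rightarrow> (real \<Rightarrow> real) \<Rightarrow> field2" where
  "b2_adj K h \<phi> = (deriv (convol (poisson h) (ext0 K \<phi>)),
                    deriv (convol (conj_poisson h) (ext0 K \<phi>)))"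

definition constrained_minimizer ::
  "real set \<Rightarrow> real set \<Rightarrow> real \<Rightarrow> real \<Rightarrow> field2 \<Rightarrow> (real \<Rightarrow> real) \<Rightarrow> bool" where
  "constrained_minimizer S K h M e \<phi>\<^sub>o \<longleftrightarrow>
     \<phi>\<^sub>o \<in> W012 K \<and> W012_norm K \<phi>\<^sub>o \<le> M \<and>
     (\<forall>\<phi> \<in> W012 K. W012_norm K \<phi> \<le> M \<longrightarrow>
        L2v_norm S (diffv (b2_adj K h \<phi>\<^sub>o) e) \<le> L2v_norm S (diffv (b2_adj K h \<phi>) e))"

end

theory Submission
  imports Defs "HOL-Complex_Analysis.Complex_Analysis"
begin

text \<open>
  Perturbing the minimizer in the direction \<open>\<psi>\<close> shows that \<open>L \<psi> = \<langle>b\<^sub>2\<^sup>* \<phi>\<^sub>o - e, b\<^sub>2\<^sup>* \<psi>\<rangle>\<close> is nonnegative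
  whenever \<open>\<langle>\<phi>\<^sub>o', \<psi>'\<rangle> < 0\<close>, and for every \<open>\<psi>\<close> if the constraint is inactive. Hence \<open>L = \<gamma> \<langle>\<phi>\<^sub>o', \<cdot>'\<rangle>\<close> with
  \<open>\<gamma> \<le> 0\<close>, and both \<open>\<gamma> = 0\<close> and an inactive constraint would force \<open>L = 0\<close>, that is
  \<open>b\<^sub>2 (b\<^sub>2\<^sup>* \<phi>\<^sub>o - e) = 0\<close> on \<open>K\<close>. This is excluded because \<open>b\<^sub>2\<close> is injective: since
  \<open>P\<^sub>h + i Q\<^sub>h = (i / \<pi>) / (x + i h)\<close>, the equation \<open>b\<^sub>2 m = 0\<close> says that the Cauchy transform of
  \<open>m\<^sub>1 + i m\<^sub>2\<close> has a derivative with vanishing imaginary part on \<open>K + i h\<close>. By analytic continuation,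
  reflection and Liouville's theorem the transform vanishes on the upper half plane, so all moments
  of \<open>m\<^sub>1 + i m\<^sub>2\<close> vanish.
\<close>

section \<open>The fundamental lemma of the calculus of variations\<close>

text \<open>The multiplier exists for a geometric reason: L and G =
  \<open>\<langle>\<phi>\<^sub>o', \<cdot>'\<rangle>\<close> are linear, and L is nonnegative on the
  open half-space G < 0. When the constraint is active and M > 0, G takes the positive value
  \<open>M\<^sup>2\<close> at \<open>\<phi>\<^sub>o\<close>, so any direction can be corrected by a
  multiple of \<open>\<phi>\<^sub>o\<close> until G is slightly negative. Applied to a direction and
  to its negative, this pins L to a multiple of G. The hard point is that the multiplier is not 0.
  The information lives on K and the unknown residual on S. The two intervals may be disjoint, so
  the only link between them is analyticity of the kernels at height h, and the argument has to pass
  through the complex plane. It returns to S through moments, which determine a density because S is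
  bounded. The fundamental lemma serves three times: weak derivatives are unique, although
  \<open>weak_deriv\<close> is a choice; orthogonality to all directions becomes a pointwise
  equation on K; vanishing moments become a vanishing density on S.\<close>

lemma DERIV_zero_if_quadratic_bound:
  fixes f :: "real \<Rightarrow> real"
  assumes "\<And>x. \<bar>f x - f y\<bar> \<le> C * (x - y)\<^sup>2"
  shows "(f has_real_derivative 0) (at y)"
proof -
  have "((\<lambda>x. C * \<bar>x - y\<bar>) \<longlongrightarrow> C * \<bar>y - y\<bar>) (at y)"
    by (intro tendsto_intros)
  then have lim: "((\<lambda>x. C * \<bar>x - y\<bar>) \<longlongrightarrow> 0) (at y)" by simp
  have "((\<lambda>x. (f x - f y) / (x - y)) \<longlongrightarrow> 0) (at y)"
  proof (rule Lim_null_comparison[OF _ lim])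
    show "\<forall>\<^sub>F x in at y. norm ((f x - f y) / (x - y)) \<le> C * \<bar>x - y\<bar>"
      using assms
      by (auto simp: eventually_at_filter abs_divide divide_le_eq power2_eq_square mult.assoc
          simp flip: abs_mult)
  qed
  then show ?thesis by (simp add: has_field_derivative_iff)
qed

text \<open>This family is closed under differentiation, so its members are smooth; for \<open>r = 1\<close>, \<open>k = 0\<close> they tend
  boundedly to the indicator of \<open>(c, d)\<close> as \<open>\<epsilon> \<rightarrow> 0\<close>.\<close>

definition bump_term :: "real \<Rightarrow> real \<Rightarrow> real \<Rightarrow> real poly \<Rightarrow> nat \<Rightarrow> real \<Rightarrow> real" where
  "bump_term \<epsilon> c d r k x =
     (if c < x \<and> x < d
      then poly r x / ((x - c) * (d - x)) ^ k * exp (- \<epsilon> / ((x - c) * (d - x))) else 0)"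

text \<open>The exponential beats every pole: with q = (x - c) * (d - x), the function exp (-
  \<epsilon> / q) / q ^ k is at most a constant times the square of q, and q is at most d - c times
  the distance from x to a point y outside the open interval. The quadratic bound yields derivative
  0 at such y, in particular at the endpoints, where two formulas meet.\<close>

lemma bump_term_flat:
  assumes "\<epsilon> > 0" "y \<le> c \<or> d \<le> y"
  shows "\<exists>C. \<forall>x. \<bar>bump_term \<epsilon> c d r k x - bump_term \<epsilon> c d r k y\<bar> \<le> C * (x - y)\<^sup>2"
proof -
  have "bounded (poly r ` {c..d})"
    by (intro compact_imp_bounded compact_continuous_image continuous_intros) simp
  then obtain R where "\<forall>x\<in>{c..d}. \<bar>poly r x\<bar> \<le> R"
    by (auto simp: bounded_iff)
  then have R: "\<bar>poly r x\<bar> \<le> R" if "x \<in> {c..d}" for x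
    using that by blast
  \<comment> \<open>From exp s \<ge> (1 + s / n) ^ n \<ge> (s / n) ^ n with s = \<epsilon> / q.
    Taking n = k + 2 leaves two powers of q after the pole has used up k of them.\<close>
  define F where "F = real (k + 2) ^ (k + 2) / \<epsilon> ^ (k + 2)"
  have "F > 0" using assms by (simp add: F_def)
  have bnd: "\<bar>bump_term \<epsilon> c d r k x\<bar> \<le> (R * F * (d - c)\<^sup>2) * (x - y)\<^sup>2" if x: "c < x" "x < d" for x
  proof -
    define q where "q = (x - c) * (d - x)"
    have q: "q > 0" using x by (simp add: q_def)
    have q_le: "q \<le> (d - c) * \<bar>x - y\<bar>"
      unfolding q_def using assms(2)
    proof
      assume "y \<le> c"
      then have "(x - c) * (d - x) \<le> \<bar>x - y\<bar> * (d - c)" using x by (intro mult_mono) auto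
      then show "(x - c) * (d - x) \<le> (d - c) * \<bar>x - y\<bar>" by (simp add: mult.commute)
    next
      assume "d \<le> y"
      then show "(x - c) * (d - x) \<le> (d - c) * \<bar>x - y\<bar>" using x by (intro mult_mono) auto
    qed
    have "(\<epsilon> / q / real (k + 2)) ^ (k + 2) \<le> (1 + \<epsilon> / q / real (k + 2)) ^ (k + 2)"
      using q assms by (intro power_mono) auto
    also have "\<dots> \<le> exp (\<epsilon> / q)"
      using q assms by (intro exp_ge_one_plus_x_over_n_power_n) (auto intro: order_trans[of _ 0])
    finally have "exp (- \<epsilon> / q) \<le> inverse ((\<epsilon> / q / real (k + 2)) ^ (k + 2))"
      using q assms by (simp add: exp_minus del: power_Suc of_nat_add)
    also have "\<dots> = F * q ^ (k + 2)"
      unfolding F_def by (simp only: power_divide inverse_divide divide_divide_eq_left divide_divide_eq_right times_divide_eq_left times_divide_eq_right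
          power_mult_distrib mult.commute)
    finally have "exp (- \<epsilon> / q) \<le> F * q ^ (k + 2)" .
    then have "exp (- \<epsilon> / q) / q ^ k \<le> F * q\<^sup>2"
      using q by (simp add: field_simps power_add power2_eq_square)
    moreover have "\<bar>poly r x\<bar> \<le> R" using R x by simp
    ultimately have "\<bar>poly r x\<bar> * (exp (- \<epsilon> / q) / q ^ k) \<le> R * (F * q\<^sup>2)"
      using q by (intro mult_mono) auto
    also have "\<dots> \<le> R * (F * ((d - c) * \<bar>x - y\<bar>)\<^sup>2)"
      using q q_le \<open>F > 0\<close> \<open>\<bar>poly r x\<bar> \<le> R\<close> by (intro mult_left_mono power_mono) auto
    finally show ?thesis
      using x q by (simp add: bump_term_def q_def[symmetric] abs_mult power_mult_distrib mult.assoc)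
  qed
  moreover have "bump_term \<epsilon> c d r k y = 0" using assms by (auto simp: bump_term_def)
  moreover have "bump_term \<epsilon> c d r k x = 0" if "\<not> (c < x \<and> x < d)" for x
    using that by (auto simp: bump_term_def)
  ultimately have "\<bar>bump_term \<epsilon> c d r k x - bump_term \<epsilon> c d r k y\<bar> \<le> \<bar>R * F * (d - c)\<^sup>2\<bar> * (x - y)\<^sup>2" for x
    by (cases "c < x \<and> x < d") (auto intro: order_trans[OF _ mult_right_mono[OF abs_ge_self]])
  then show ?thesis by blast
qed

text \<open>Inside the interval the exponential contributes \<epsilon> q' over the square of q, so
  the common denominator gains two powers; this fixes both the new polynomial and the order k + 2.
  Outside, every member of the family is 0 and flatness gives derivative 0.\<close>

lemma bump_term_deriv:
  fixes c d :: real
  defines "q \<equiv> [:- c, 1:] * [:d, - 1:]"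
  assumes "\<epsilon> > 0"
  shows "(bump_term \<epsilon> c d r k has_real_derivative
     bump_term \<epsilon> c d (pderiv r * q\<^sup>2 - of_nat k * r * pderiv q * q + smult \<epsilon> (r * pderiv q)) (k + 2) x) (at x)"
proof (cases "c < x \<and> x < d")
  case True
  have q: "poly q y = (y - c) * (d - y)" for y by (simp add: q_def algebra_simps)
  have qx: "poly q x > 0" using True by (simp add: q)
  have "((\<lambda>y. poly r y / poly q y ^ k * exp (- \<epsilon> / poly q y)) has_real_derivative
     poly (pderiv r * q\<^sup>2 - of_nat k * r * pderiv q * q + smult \<epsilon> (r * pderiv q)) x
       / poly q x ^ (k + 2) * exp (- \<epsilon> / poly q x)) (at x)"
  proof (rule DERIV_cong)
    show "((\<lambda>y. poly r y / poly q y ^ k * exp (- \<epsilon> / poly q y)) has_real_derivative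
      poly r x / poly q x ^ k * (exp (- \<epsilon> / poly q x) * ((0 * poly q x - - \<epsilon> * poly (pderiv q) x) / (poly q x * poly q x)))
      + (poly (pderiv r) x * poly q x ^ k - poly r x * (of_nat k * (poly (pderiv q) x * poly q x ^ (k - Suc 0))))
        / (poly q x ^ k * poly q x ^ k) * exp (- \<epsilon> / poly q x)) (at x)"
      using qx by (intro DERIV_mult' DERIV_divide DERIV_fun_exp DERIV_power poly_DERIV DERIV_const) auto
    \<comment> \<open>For k = 0 the truncated exponent is wrong, but the factor k makes both sides
      0.\<close>
    have "real k * poly q x ^ (k - Suc 0) = real k * poly q x ^ k / poly q x"
      using qx by (cases k) auto
    then have pw: "of_nat k * (poly (pderiv q) x * poly q x ^ (k - Suc 0)) = poly (pderiv q) x * (real k * poly q x ^ k / poly q x)"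
      by (metis mult.left_commute)
    show "poly r x / poly q x ^ k * (exp (- \<epsilon> / poly q x) * ((0 * poly q x - - \<epsilon> * poly (pderiv q) x) / (poly q x * poly q x)))
      + (poly (pderiv r) x * poly q x ^ k - poly r x * (of_nat k * (poly (pderiv q) x * poly q x ^ (k - Suc 0))))
        / (poly q x ^ k * poly q x ^ k) * exp (- \<epsilon> / poly q x)
      = poly (pderiv r * q\<^sup>2 - of_nat k * r * pderiv q * q + smult \<epsilon> (r * pderiv q)) x
        / poly q x ^ (k + 2) * exp (- \<epsilon> / poly q x)"
      using qx unfolding pw by (simp add: field_simps power2_eq_square)
  qed
  then have "(bump_term \<epsilon> c d r k has_real_derivative
     poly (pderiv r * q\<^sup>2 - of_nat k * r * pderiv q * q + smult \<epsilon> (r * pderiv q)) x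
       / poly q x ^ (k + 2) * exp (- \<epsilon> / poly q x)) (at x)"
    by (rule has_field_derivative_transform_within_open[where S = "{c<..<d}"])
       (use True in \<open>auto simp: bump_term_def q\<close>)
  then show ?thesis using True by (simp add: bump_term_def q)
next
  case False
  then obtain C where "\<forall>y. \<bar>bump_term \<epsilon> c d r k y - bump_term \<epsilon> c d r k x\<bar> \<le> C * (y - x)\<^sup>2"
    using bump_term_flat[OF assms(2), of x c d r k] by force
  then have "(bump_term \<epsilon> c d r k has_real_derivative 0) (at x)"
    by (blast intro: DERIV_zero_if_quadratic_bound)
  moreover have "bump_term \<epsilon> c d r' k' x = 0" for r' k'
    using False by (auto simp: bump_term_def)
  ultimately show ?thesis by simp
qed

lemma bump_term_test_function:
  assumes "\<epsilon> > 0" "{c..d} \<subseteq> K"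
  shows "bump_term \<epsilon> c d r k \<in> test_functions K"
proof -
  have deriv: "\<exists>r' k'. deriv (bump_term \<epsilon> c d r k) = bump_term \<epsilon> c d r' k'" for r k
    using DERIV_imp_deriv[OF bump_term_deriv[OF assms(1)]] by blast
  have iter: "\<exists>r' k'. (deriv ^^ n) (bump_term \<epsilon> c d r k) = bump_term \<epsilon> c d r' k'" for n
  proof (induction n)
    case (Suc n)
    then obtain r' k' where "(deriv ^^ n) (bump_term \<epsilon> c d r k) = bump_term \<epsilon> c d r' k'"
      by blast
    then show ?case using deriv[of r' k'] by simp
  qed auto
  have "(deriv ^^ n) (bump_term \<epsilon> c d r k) differentiable (at x)" for n x
  proof -
    obtain r' k' where "(deriv ^^ n) (bump_term \<epsilon> c d r k) = bump_term \<epsilon> c d r' k'"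
      using iter by blast
    then show ?thesis
      using bump_term_deriv[OF assms(1), of c d r' k' x] by (auto simp: real_differentiable_def)
  qed
  moreover have "\<forall>x. x \<notin> {c..d} \<longrightarrow> bump_term \<epsilon> c d r k x = 0"
    by (auto simp: bump_term_def)
  ultimately show ?thesis
    using assms(2) unfolding test_functions_def by (blast intro: compact_Icc)
qed

text \<open>Dominated convergence passes from bounded intervals to the half-lines
  \<open>{..a}\<close>. These are stable under intersection and generate the Borel sets, so
  induction over disjoint unions and complements reaches every Borel set.\<close>

lemma AE_zero_if_integrals_Ioo_zero:
  fixes g :: "real \<Rightarrow> real"
  assumes g: "integrable lborel g" and zero: "\<And>c d. c < d \<Longrightarrow> (LINT x:{c<..<d}|lborel. g x) = 0"
  shows "AE x in lborel. g x = 0"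
proof (rule sigma_finite_measure.density_zero[OF lborel.sigma_finite_measure_axioms g])
  fix A :: "real set" assume "A \<in> sets lborel"
  then have A: "A \<in> sigma_sets UNIV (range (\<lambda>a. {..a::real}))"
    by (simp add: borel_eq_atMost)
  note [measurable] = borel_measurable_integrable[OF g]
  have int: "set_integrable lborel B g" if "B \<in> sets borel" for B
    unfolding set_integrable_def using that g by (intro integrable_mult_indicator) auto
  have half: "(LINT x:{..a}|lborel. g x) = 0" for a
  proof -
    have "(\<lambda>n. LINT x|lborel. indicator {a - real (Suc n)<..<a} x *\<^sub>R g x) \<longlonglongrightarrow> (LINT x|lborel. indicator {..<a} x *\<^sub>R g x)"
    proof (rule integral_dominated_convergence[where w = "\<lambda>x. norm (g x)"])
      have "(\<lambda>n. indicator {a - real (Suc n)<..<a} x *\<^sub>R g x) \<longlonglongrightarrow> indicator {..<a} x *\<^sub>R g x" for x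
      proof -
        obtain N where "a - x < real N" using reals_Archimedean2 by blast
        then have "\<forall>\<^sub>F n in sequentially. indicator {a - real (Suc n)<..<a} x *\<^sub>R g x = indicator {..<a} x *\<^sub>R g x"
          by (intro eventually_sequentiallyI[of N]) (auto simp: indicator_def)
        then show ?thesis by (rule tendsto_eventually)
      qed
      then show "AE x in lborel. (\<lambda>n. indicator {a - real (Suc n)<..<a} x *\<^sub>R g x) \<longlonglongrightarrow> indicator {..<a} x *\<^sub>R g x"
        by simp
    qed (use g in \<open>auto simp: indicator_def\<close>)
    moreover have "(LINT x|lborel. indicator {a - real (Suc n)<..<a} x *\<^sub>R g x) = 0" for n
      using zero[of "a - real (Suc n)" a] by (simp add: set_lebesgue_integral_def)
    ultimately have "(LINT x:{..<a}|lborel. g x) = 0"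
      by (simp add: set_lebesgue_integral_def LIMSEQ_const_iff)
    moreover have "(LINT x:{..a}|lborel. g x) = (LINT x:{..<a}|lborel. g x)"
    proof (rule set_integral_cong_set)
      have "AE x in lborel. x \<noteq> a" by (rule AE_lborel_singleton)
      then show "AE x in lborel. (x \<in> {..<a}) = (x \<in> {..a})" by eventually_elim auto
    qed (auto simp: set_borel_measurable_def)
    ultimately show ?thesis by simp
  qed
  \<comment> \<open>The complement step of the induction subtracts from the integral over the whole
    line.\<close>
  have univ: "(LINT x:UNIV|lborel. g x) = 0"
  proof -
    have "(\<lambda>n. LINT x|lborel. indicator {..real n} x *\<^sub>R g x) \<longlonglongrightarrow> (LINT x|lborel. indicator UNIV x *\<^sub>R g x)"
    proof (rule integral_dominated_convergence[where w = "\<lambda>x. norm (g x)"])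
      have "(\<lambda>n. indicator {..real n} x *\<^sub>R g x) \<longlonglongrightarrow> indicator UNIV x *\<^sub>R g x" for x
      proof -
        obtain N where "x < real N" using reals_Archimedean2 by blast
        then have "\<forall>\<^sub>F n in sequentially. indicator {..real n} x *\<^sub>R g x = indicator UNIV x *\<^sub>R g x"
          by (intro eventually_sequentiallyI[of N]) (auto simp: indicator_def)
        then show ?thesis by (rule tendsto_eventually)
      qed
      then show "AE x in lborel. (\<lambda>n. indicator {..real n} x *\<^sub>R g x) \<longlonglongrightarrow> indicator UNIV x *\<^sub>R g x"
        by simp
    qed (use g in \<open>auto simp: indicator_def\<close>)
    moreover have "(LINT x|lborel. indicator {..real n} x *\<^sub>R g x) = 0" for n
      using half[of "real n"] by (simp add: set_lebesgue_integral_def)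
    ultimately show ?thesis by (simp add: set_lebesgue_integral_def LIMSEQ_const_iff)
  qed
  have borel: "B \<in> sets borel" if "B \<in> sigma_sets UNIV (range (\<lambda>a. {..a::real}))" for B
    using that by (simp add: borel_eq_atMost)
  have stable: "Int_stable (range (\<lambda>a. {..a::real}))"
    by (auto simp: Int_stable_def)
  have gen: "range (\<lambda>a. {..a::real}) \<subseteq> Pow UNIV" by simp
  show "(LINT x:A|lborel. g x) = 0"
    using stable gen A
  proof (induction rule: sigma_sets_induct_disjoint)
    case (compl B)
    have "(LINT x:(UNIV - B) \<union> B|lborel. g x) = (LINT x:UNIV - B|lborel. g x) + (LINT x:B|lborel. g x)"
      using borel[OF compl(1)] by (intro set_integral_Un int) auto
    then show ?case using compl(2) univ by simp
  next
    case (union B)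
    then have [measurable]: "B i \<in> sets borel" for i using borel by blast
    from union have "(LINT x:(\<Union>i. B i)|lborel. g x) = (\<Sum>i. (LINT x:(B i)|lborel. g x))"
      by (intro lebesgue_integral_countable_add int) (auto simp: disjoint_family_on_def)
    then show ?case using union by simp
  qed (use half in \<open>auto simp: set_lebesgue_integral_def\<close>)
qed

text \<open>Smooth bumps converge boundedly to the indicator of a subinterval, which reduces the
  claim to integrals over intervals.\<close>

lemma fundamental_lemma_test_functions:
  fixes g :: "real \<Rightarrow> real"
  assumes g: "set_integrable lborel {a<..<b} g"
    and zero: "\<And>\<eta>. \<eta> \<in> test_functions {a<..<b} \<Longrightarrow> (LINT x:{a<..<b}|lborel. g x * \<eta> x) = 0"
  shows "AE x in lborel. x \<in> {a<..<b} \<longrightarrow> g x = 0"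
proof -
  define G where "G x = indicator {a<..<b} x * g x" for x
  have G: "integrable lborel G" using g by (simp add: set_integrable_def G_def[abs_def])
  note [measurable] = borel_measurable_integrable[OF G]
  have "AE x in lborel. G x = 0"
  proof (rule AE_zero_if_integrals_Ioo_zero[OF G])
    fix c' d' :: real
    \<comment> \<open>An interval that sticks out of (a, b) may be cut down to it because
      \<open>G\<close> vanishes outside. If the cut is empty, the limit is the indicator of the
      empty set.\<close>
    define c d where "c = max a c'" and "d = min b d'"
    \<comment> \<open>The ends move inwards so that the closed support stays inside (a, b) even when
      c = a or d = b; the shrinking first parameter drives the exponential to 1. If the shrunken
      interval is empty, the bump is the zero function.\<close>
    define \<eta> where "\<eta> n = bump_term (1 / Suc n) (c + 1 / Suc n) (d - 1 / Suc n) 1 0" for n :: nat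
    have \<eta>: "\<eta> n \<in> test_functions {a<..<b}" for n
    proof -
      have "a < c + 1 / Suc n" "d - 1 / Suc n < b"
        using divide_pos_pos[of 1 "real (Suc n)"] unfolding c_def d_def by linarith+
      then have "{c + 1 / Suc n..d - 1 / Suc n} \<subseteq> {a<..<b}"
        by auto
      then show ?thesis unfolding \<eta>_def by (intro bump_term_test_function) auto
    qed
    have cont: "continuous_on UNIV (\<eta> n)" for n
      unfolding \<eta>_def by (intro DERIV_continuous_on[OF bump_term_deriv]) auto
    have [measurable]: "\<eta> n \<in> borel_measurable borel" for n
      by (intro borel_measurable_continuous_onI cont)
    have "(\<lambda>n. LINT x|lborel. G x * \<eta> n x) \<longlonglongrightarrow> (LINT x|lborel. G x * indicator {c<..<d} x)"
    proof (rule integral_dominated_convergence[where w = "\<lambda>x. norm (G x)"])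
      have "(\<lambda>n. \<eta> n x) \<longlonglongrightarrow> indicator {c<..<d} x" for x
      proof (cases "c < x \<and> x < d")
        case True
        have null: "(\<lambda>n. 1 / real (Suc n)) \<longlonglongrightarrow> 0"
          by (rule LIMSEQ_Suc[OF lim_1_over_n])
        have "(\<lambda>n. c + 1 / Suc n) \<longlonglongrightarrow> c + 0" "(\<lambda>n. d - 1 / Suc n) \<longlonglongrightarrow> d - 0"
          by (intro tendsto_intros null)+
        then have "\<forall>\<^sub>F n in sequentially. c + 1 / Suc n < x" "\<forall>\<^sub>F n in sequentially. x < d - 1 / Suc n"
          using True by (auto dest: order_tendstoD)
        then have "\<forall>\<^sub>F n in sequentially. exp (- (1 / Suc n) / ((x - (c + 1 / Suc n)) * (d - 1 / Suc n - x))) = \<eta> n x"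
          by eventually_elim (simp add: \<eta>_def bump_term_def)
        moreover have "(\<lambda>n. exp (- (1 / Suc n) / ((x - (c + 1 / Suc n)) * (d - 1 / Suc n - x)))) \<longlonglongrightarrow> exp (- 0 / ((x - (c + 0)) * (d - 0 - x)))"
          using True by (intro tendsto_intros null) auto
        ultimately have "(\<lambda>n. \<eta> n x) \<longlonglongrightarrow> exp (- 0 / ((x - (c + 0)) * (d - 0 - x)))"
          by (rule Lim_transform_eventually[rotated])
        then show ?thesis using True by simp
      next
        case False
        have "\<eta> n x = 0" for n
        proof -
          have "c \<le> c + 1 / Suc n" "d - 1 / Suc n \<le> d" by auto
          then have "\<not> (c + 1 / Suc n < x \<and> x < d - 1 / Suc n)"
            using False by linarith
          then show ?thesis by (simp only: \<eta>_def bump_term_def if_False)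
        qed
        moreover have "indicator {c<..<d} x = (0::real)" using False by auto
        ultimately show ?thesis by simp
      qed
      then show "AE x in lborel. (\<lambda>n. G x * \<eta> n x) \<longlonglongrightarrow> G x * indicator {c<..<d} x"
        by (auto intro!: tendsto_mult)
      have "\<bar>\<eta> n x\<bar> \<le> 1" for n x by (auto simp: \<eta>_def bump_term_def)
      then show "AE x in lborel. norm (G x * \<eta> n x) \<le> norm (G x)" for n
        by (simp add: abs_mult mult_left_le)
    qed (use G in auto)
    moreover have "(LINT x|lborel. G x * \<eta> n x) = 0" for n
      using zero[OF \<eta>[of n]] by (simp add: set_lebesgue_integral_def G_def mult.assoc)
    ultimately have "(LINT x|lborel. G x * indicator {c<..<d} x) = 0"
      by (simp add: LIMSEQ_const_iff)
    moreover have "G x * indicator {c<..<d} x = indicator {c'<..<d'} x *\<^sub>R G x" for x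
      by (auto simp: G_def c_def d_def indicator_def)
    ultimately show "(LINT x:{c'<..<d'}|lborel. G x) = 0"
      by (simp add: set_lebesgue_integral_def)
  qed
  then show ?thesis by (rule eventually_mono) (auto simp: G_def)
qed

section \<open>\<open>L\<^sup>2\<close> and \<open>W\<^sub>0\<^sup>1\<^sup>,\<^sup>2\<close> on an interval\<close>

lemma L2_iff:
  "f \<in> L2 A \<longleftrightarrow> (\<lambda>x. indicator A x * f x) \<in> borel_measurable lborel \<and>
     integrable lborel (\<lambda>x. indicator A x * (f x)\<^sup>2)"
  by (simp add: L2_def set_borel_measurable_def set_integrable_def)

lemma
  assumes "f \<in> L2 A"
  shows L2_measurable: "(\<lambda>x. indicator A x * f x) \<in> borel_measurable lborel"
    and L2_square_integrable: "integrable lborel (\<lambda>x. indicator A x * (f x)\<^sup>2)"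
  using assms by (auto simp: L2_iff)

lemma L2_mult_integrable:
  assumes "f \<in> L2 A" "g \<in> L2 A"
  shows "set_integrable lborel A (\<lambda>x. f x * g x)"
  unfolding set_integrable_def
proof (rule Bochner_Integration.integrable_bound)
  show "integrable lborel (\<lambda>x. indicator A x * (f x)\<^sup>2 + indicator A x * (g x)\<^sup>2)"
    using assms by (simp add: L2_iff)
  have eq: "indicator A x *\<^sub>R (f x * g x) = (indicator A x * f x) * (indicator A x * g x)" for x :: real
    by (auto simp: indicator_def)
  show "(\<lambda>x. indicator A x *\<^sub>R (f x * g x)) \<in> borel_measurable lborel"
    unfolding eq using assms by (intro borel_measurable_times L2_measurable)
  have "\<bar>f x * g x\<bar> \<le> (f x)\<^sup>2 + (g x)\<^sup>2" for x
    using sum_squares_bound[of "\<bar>f x\<bar>" "\<bar>g x\<bar>"] abs_ge_zero[of "f x * g x"]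
    unfolding power2_abs abs_mult by linarith
  then show "AE x in lborel. norm (indicator A x *\<^sub>R (f x * g x))
      \<le> norm (indicator A x * (f x)\<^sup>2 + indicator A x * (g x)\<^sup>2)"
    by (intro AE_I2) (auto simp: indicator_def abs_mult)
qed

lemma L2_lin:
  assumes f: "f \<in> L2 A" and g: "g \<in> L2 A"
  shows "(\<lambda>x. a * f x + b * g x) \<in> L2 A"
proof -
  have 1: "indicator A x * (a * f x + b * g x) = a * (indicator A x * f x) + b * (indicator A x * g x)" for x :: real
    by (simp add: algebra_simps)
  have 2: "indicator A x * (a * f x + b * g x)\<^sup>2
     = a\<^sup>2 * (indicator A x * (f x)\<^sup>2) + 2 * a * b * (indicator A x * (f x * g x)) + b\<^sup>2 * (indicator A x * (g x)\<^sup>2)" for x :: real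
    by (simp add: power2_eq_square algebra_simps)
  have 3: "integrable lborel (\<lambda>x. indicator A x * (f x * g x))"
    using L2_mult_integrable[OF f g] by (simp add: set_integrable_def)
  show ?thesis
    unfolding L2_iff 1 2 using f g 3
    by (intro conjI borel_measurable_add borel_measurable_times borel_measurable_const L2_measurable
        L2_square_integrable Bochner_Integration.integrable_add integrable_mult_right)
qed

lemma L2_diff: "f \<in> L2 A \<Longrightarrow> g \<in> L2 A \<Longrightarrow> (\<lambda>x. f x - g x) \<in> L2 A"
  using L2_lin[of f A g 1 "-1"] by simp

lemma L2_inner_commute: "L2_inner A f g = L2_inner A g f"
  by (simp add: L2_inner_def mult.commute)

lemma L2_inner_nonneg: "0 \<le> L2_inner A f f"
  by (simp add: L2_inner_def set_lebesgue_integral_def)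

lemma L2_inner_lin_left:
  assumes "f \<in> L2 A" "g \<in> L2 A" "k \<in> L2 A"
  shows "L2_inner A (\<lambda>x. a * f x + b * g x) k = a * L2_inner A f k + b * L2_inner A g k"
proof -
  have "L2_inner A (\<lambda>x. a * f x + b * g x) k = (LINT x:A|lborel. a * (f x * k x) + b * (g x * k x))"
    by (simp add: L2_inner_def algebra_simps)
  also have "\<dots> = (LINT x:A|lborel. a * (f x * k x)) + (LINT x:A|lborel. b * (g x * k x))"
    using assms by (intro set_integral_add set_integrable_mult_right L2_mult_integrable)
  finally show ?thesis by (simp add: L2_inner_def)
qed

lemma L2_inner_lin_right:
  assumes "f \<in> L2 A" "g \<in> L2 A" "k \<in> L2 A"
  shows "L2_inner A k (\<lambda>x. a * f x + b * g x) = a * L2_inner A k f + b * L2_inner A k g"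
  using L2_inner_lin_left[OF assms] by (simp add: L2_inner_commute)

lemma L2_inner_square:
  assumes "f \<in> L2 A" "g \<in> L2 A"
  shows "L2_inner A (\<lambda>x. f x + t * g x) (\<lambda>x. f x + t * g x)
    = L2_inner A f f + 2 * t * L2_inner A f g + t\<^sup>2 * L2_inner A g g"
proof -
  define k where "k = (\<lambda>x. f x + t * g x)"
  have k: "k = (\<lambda>x. 1 * f x + t * g x)" by (simp add: k_def)
  have "k \<in> L2 A" unfolding k by (rule L2_lin[OF assms])
  then have "L2_inner A k k = L2_inner A f k + t * L2_inner A g k"
    using L2_inner_lin_left[OF assms, of k 1 t] by (simp add: k)
  also have "L2_inner A f k = L2_inner A f f + t * L2_inner A f g"
    using L2_inner_lin_right[OF assms assms(1), of 1 t] by (simp add: k)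
  also have "L2_inner A g k = L2_inner A g f + t * L2_inner A g g"
    using L2_inner_lin_right[OF assms assms(2), of 1 t] by (simp add: k)
  finally show ?thesis
    by (simp add: k_def L2_inner_commute[of A g f] power2_eq_square algebra_simps)
qed

lemma L2_inner_cong_ae:
  assumes "f \<in> L2 A" "f' \<in> L2 A" "g \<in> L2 A" "g' \<in> L2 A" "eq_ae A f f'" "eq_ae A g g'"
  shows "L2_inner A f g = L2_inner A f' g'"
  unfolding L2_inner_def set_lebesgue_integral_def
proof (rule integral_cong_AE)
  show "(\<lambda>x. indicator A x *\<^sub>R (f x * g x)) \<in> borel_measurable lborel"
    "(\<lambda>x. indicator A x *\<^sub>R (f' x * g' x)) \<in> borel_measurable lborel"
    using L2_mult_integrable assms unfolding set_integrable_def
    by (blast intro: borel_measurable_integrable)+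
  show "AE x in lborel. indicator A x *\<^sub>R (f x * g x) = indicator A x *\<^sub>R (f' x * g' x)"
    using assms(5,6) unfolding eq_ae_def by eventually_elim (auto simp: indicator_def)
qed

lemma continuous_L2:
  fixes f :: "real \<Rightarrow> real"
  assumes f: "continuous_on UNIV f" and A: "bounded A" "A \<in> sets borel"
  shows "f \<in> L2 A"
proof -
  have [measurable]: "f \<in> borel_measurable borel" "A \<in> sets borel"
    using f A by (auto intro: borel_measurable_continuous_onI)
  have "compact (closure A)" using A by simp
  moreover have "continuous_on (closure A) (\<lambda>x. (f x)\<^sup>2)"
    using f by (intro continuous_intros) (auto intro: continuous_on_subset)
  ultimately have "integrable lborel (\<lambda>x. indicator (closure A) x *\<^sub>R (f x)\<^sup>2)"
    by (rule borel_integrable_compact)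
  then have "integrable lborel (\<lambda>x. indicator A x * (f x)\<^sup>2)"
  proof (rule Bochner_Integration.integrable_bound)
    show "AE x in lborel. norm (indicator A x * (f x)\<^sup>2) \<le> norm (indicator (closure A) x *\<^sub>R (f x)\<^sup>2)"
      using closure_subset by (intro AE_I2) (auto simp: indicator_def)
  qed measurable
  then show ?thesis by (simp add: L2_iff)
qed

text \<open>On a bounded set the constant 1 is square integrable, so this is the product of two
  \<open>L2\<close> functions.\<close>

lemma L2_set_integrable:
  assumes "f \<in> L2 A" "bounded A" "A \<in> sets borel"
  shows "set_integrable lborel A f"
  using L2_mult_integrable[OF assms(1) continuous_L2[of "\<lambda>_. 1", OF _ assms(2,3)]] by simp

section \<open>Test functions and weak derivatives\<close>

lemma test_function_properties:
  assumes "\<eta> \<in> test_functions K"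
  shows "(\<eta> has_real_derivative deriv \<eta> x) (at x)"
    and "continuous_on UNIV \<eta>" "continuous_on UNIV (deriv \<eta>)"
    and "x \<notin> K \<Longrightarrow> \<eta> x = 0"
proof -
  have *: "((deriv ^^ n) \<eta>) differentiable (at x)" for n x
    using assms by (simp add: test_functions_def)
  show "(\<eta> has_real_derivative deriv \<eta> x) (at x)" for x
    using *[of 0 x] by (simp add: DERIV_deriv_iff_real_differentiable)
  show "continuous_on UNIV \<eta>"
    using *[of 0] by (auto intro!: differentiable_imp_continuous_on simp: differentiable_on_def)
  show "continuous_on UNIV (deriv \<eta>)"
    using *[of 1] by (auto intro!: differentiable_imp_continuous_on simp: differentiable_on_def)
  show "x \<notin> K \<Longrightarrow> \<eta> x = 0"
    using assms by (auto simp: test_functions_def)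
qed

lemma test_function_L2:
  assumes "\<eta> \<in> test_functions {a<..<b}"
  shows "\<eta> \<in> L2 {a<..<b}" "deriv \<eta> \<in> L2 {a<..<b}"
  using test_function_properties[OF assms] by (auto intro!: continuous_L2)

lemma test_function_has_weak_deriv:
  assumes \<eta>: "\<eta> \<in> test_functions {a<..<b}" and "a < b"
  shows "has_weak_deriv {a<..<b} \<eta> (deriv \<eta>)"
  unfolding has_weak_deriv_def
proof
  fix \<theta> assume \<theta>: "\<theta> \<in> test_functions {a<..<b}"
  note H = test_function_properties[OF \<eta>] and T = test_function_properties[OF \<theta>]
  have int: "set_integrable lborel {a<..<b} (\<lambda>x. \<eta> x * deriv \<theta> x)"
    "set_integrable lborel {a<..<b} (\<lambda>x. deriv \<eta> x * \<theta> x)"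
    using test_function_L2[OF \<eta>] test_function_L2[OF \<theta>] by (auto intro: L2_mult_integrable)
  have ends: "\<eta> a = 0" "\<eta> b = 0" "\<theta> a = 0" "\<theta> b = 0"
    using H(4) T(4) by auto
  have "L2_inner {a<..<b} \<eta> (deriv \<theta>) + L2_inner {a<..<b} (deriv \<eta>) \<theta>
      = (LINT x:{a<..<b}|lborel. \<eta> x * deriv \<theta> x + deriv \<eta> x * \<theta> x)"
    unfolding L2_inner_def using int by (simp add: set_integral_add)
  \<comment> \<open>Both test functions vanish at a and b, hence so does the integrand, and the
    closed interval required by the fundamental theorem of calculus may replace the open
    one.\<close>
  also have "\<dots> = (LINT x|lborel. indicator {a..b} x *\<^sub>R (\<eta> x * deriv \<theta> x + deriv \<eta> x * \<theta> x))"
    unfolding set_lebesgue_integral_def using ends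
    by (intro Bochner_Integration.integral_cong) (auto simp: indicator_def less_le)
  also have "\<dots> = \<eta> b * \<theta> b - \<eta> a * \<theta> a"
  proof (rule integral_FTC_atLeastAtMost)
    show "((\<lambda>x. \<eta> x * \<theta> x) has_vector_derivative \<eta> x * deriv \<theta> x + deriv \<eta> x * \<theta> x) (at x within {a..b})" for x
      using DERIV_mult'[OF H(1) T(1)]
      by (auto intro: has_vector_derivative_at_within simp: has_real_derivative_iff_has_vector_derivative)
    show "continuous_on {a..b} (\<lambda>x. \<eta> x * deriv \<theta> x + deriv \<eta> x * \<theta> x)"
      using H(2,3) T(2,3) by (intro continuous_intros) (auto intro: continuous_on_subset)
  qed (use \<open>a < b\<close> in simp)
  finally show "L2_inner {a<..<b} \<eta> (deriv \<theta>) = - L2_inner {a<..<b} (deriv \<eta>) \<theta>"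
    using ends by simp
qed

text \<open>Makes test functions admissible directions, so that orthogonality to \<open>W012\<close>
  can be exploited by the fundamental lemma.\<close>

lemma test_function_W012:
  assumes \<eta>: "\<eta> \<in> test_functions {a<..<b}" and "a < b"
  shows "\<eta> \<in> W012 {a<..<b}"
proof -
  have "continuous_on (closure {a<..<b}) \<eta>"
    using test_function_properties(2)[OF \<eta>] by (rule continuous_on_subset) simp
  moreover have "\<forall>x\<in>frontier {a<..<b}. \<eta> x = 0"
    using test_function_properties(4)[OF \<eta>] by (simp add: frontier_def interior_open)
  moreover have "eq_ae {a<..<b} \<eta> \<eta>" by (simp add: eq_ae_def)
  ultimately show ?thesis
    using test_function_L2[OF \<eta>] test_function_has_weak_deriv[OF assms]
    unfolding W012_def by blast
qed

lemma has_weak_deriv_lin: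
  assumes "has_weak_deriv {a<..<b} \<phi> f" "has_weak_deriv {a<..<b} \<psi> g"
    and "\<phi> \<in> L2 {a<..<b}" "f \<in> L2 {a<..<b}" "\<psi> \<in> L2 {a<..<b}" "g \<in> L2 {a<..<b}"
  shows "has_weak_deriv {a<..<b} (\<lambda>x. s * \<phi> x + t * \<psi> x) (\<lambda>x. s * f x + t * g x)"
  unfolding has_weak_deriv_def
proof
  fix \<eta> assume \<eta>: "\<eta> \<in> test_functions {a<..<b}"
  show "L2_inner {a<..<b} (\<lambda>x. s * \<phi> x + t * \<psi> x) (deriv \<eta>) =
      - L2_inner {a<..<b} (\<lambda>x. s * f x + t * g x) \<eta>"
    using assms \<eta> test_function_L2[OF \<eta>]
    by (simp add: L2_inner_lin_left has_weak_deriv_def)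
qed

lemma eq_ae_if_test_function_integrals_eq:
  assumes f: "f \<in> L2 {a<..<b}" and g: "g \<in> L2 {a<..<b}"
    and eq: "\<And>\<eta>. \<eta> \<in> test_functions {a<..<b} \<Longrightarrow> L2_inner {a<..<b} f \<eta> = L2_inner {a<..<b} g \<eta>"
  shows "eq_ae {a<..<b} f g"
proof -
  have "AE x in lborel. x \<in> {a<..<b} \<longrightarrow> 1 * f x + (- 1) * g x = 0"
  proof (rule fundamental_lemma_test_functions)
    show "set_integrable lborel {a<..<b} (\<lambda>x. 1 * f x + (- 1) * g x)"
      using f g by (intro L2_set_integrable L2_lin) auto
    show "(LINT x:{a<..<b}|lborel. (1 * f x + (- 1) * g x) * \<eta> x) = 0"
      if "\<eta> \<in> test_functions {a<..<b}" for \<eta>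
      using L2_inner_lin_left[OF f g test_function_L2(1)[OF that], of 1 "- 1"] eq[OF that]
      by (simp add: L2_inner_def)
  qed
  then show ?thesis by (simp add: eq_ae_def)
qed

lemma has_weak_deriv_unique:
  assumes "has_weak_deriv {a<..<b} \<phi> f" "has_weak_deriv {a<..<b} \<phi> g"
    and "f \<in> L2 {a<..<b}" "g \<in> L2 {a<..<b}"
  shows "eq_ae {a<..<b} f g"
  using assms by (intro eq_ae_if_test_function_integrals_eq) (auto simp: has_weak_deriv_def)

lemma weak_deriv_W012:
  assumes "\<phi> \<in> W012 K"
  shows "weak_deriv K \<phi> \<in> L2 K" "has_weak_deriv K \<phi> (weak_deriv K \<phi>)"
proof -
  have "\<exists>g. g \<in> L2 K \<and> has_weak_deriv K \<phi> g"
    using assms by (auto simp: W012_def)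
  then have "weak_deriv K \<phi> \<in> L2 K \<and> has_weak_deriv K \<phi> (weak_deriv K \<phi>)"
    unfolding weak_deriv_def by (rule someI_ex)
  then show "weak_deriv K \<phi> \<in> L2 K" "has_weak_deriv K \<phi> (weak_deriv K \<phi>)" by auto
qed

lemma W012_L2: "\<phi> \<in> W012 K \<Longrightarrow> \<phi> \<in> L2 K"
  by (simp add: W012_def)

lemma W012_lin:
  assumes \<phi>: "\<phi> \<in> W012 {a<..<b}" and \<psi>: "\<psi> \<in> W012 {a<..<b}"
  shows "(\<lambda>x. s * \<phi> x + t * \<psi> x) \<in> W012 {a<..<b}"
proof -
  let ?K = "{a<..<b}"
  from \<phi> obtain u where u: "continuous_on (closure ?K) u" "\<forall>x\<in>frontier ?K. u x = 0" "eq_ae ?K \<phi> u"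
    unfolding W012_def by blast
  from \<psi> obtain v where v: "continuous_on (closure ?K) v" "\<forall>x\<in>frontier ?K. v x = 0" "eq_ae ?K \<psi> v"
    unfolding W012_def by blast
  have "continuous_on (closure ?K) (\<lambda>x. s * u x + t * v x)"
    using u v by (intro continuous_intros)
  moreover have "\<forall>x\<in>frontier ?K. s * u x + t * v x = 0"
    using u v by simp
  moreover have "eq_ae ?K (\<lambda>x. s * \<phi> x + t * \<psi> x) (\<lambda>x. s * u x + t * v x)"
    using u(3) v(3) unfolding eq_ae_def by eventually_elim auto
  moreover have "has_weak_deriv ?K (\<lambda>x. s * \<phi> x + t * \<psi> x)
      (\<lambda>x. s * weak_deriv ?K \<phi> x + t * weak_deriv ?K \<psi> x)"
    using assms by (intro has_weak_deriv_lin weak_deriv_W012 W012_L2)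
  moreover have "(\<lambda>x. s * weak_deriv ?K \<phi> x + t * weak_deriv ?K \<psi> x) \<in> L2 ?K"
    using assms by (intro L2_lin weak_deriv_W012)
  moreover have "(\<lambda>x. s * \<phi> x + t * \<psi> x) \<in> L2 ?K"
    using assms by (intro L2_lin W012_L2)
  ultimately show ?thesis unfolding W012_def by blast
qed

text \<open>\<open>weak_deriv\<close> picks an arbitrary representative for each function, so
  linearity can hold only up to \<open>eq_ae\<close>; it comes from uniqueness of the weak
  derivative.\<close>

lemma weak_deriv_lin:
  assumes \<phi>: "\<phi> \<in> W012 {a<..<b}" and \<psi>: "\<psi> \<in> W012 {a<..<b}"
  shows "eq_ae {a<..<b} (weak_deriv {a<..<b} (\<lambda>x. s * \<phi> x + t * \<psi> x))
     (\<lambda>x. s * weak_deriv {a<..<b} \<phi> x + t * weak_deriv {a<..<b} \<psi> x)"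
  using assms
  by (intro has_weak_deriv_unique[OF weak_deriv_W012(2) has_weak_deriv_lin]
      W012_lin weak_deriv_W012 W012_L2 L2_lin)

section \<open>Cauchy transforms\<close>

lemma integrable_mult_bounded:
  fixes m k :: "real \<Rightarrow> 'a :: {real_normed_field, banach, second_countable_topology}"
  assumes m: "integrable lborel m" and k: "k \<in> borel_measurable borel" "\<And>t. norm (k t) \<le> B"
  shows "integrable lborel (\<lambda>t. m t * k t)"
proof (rule Bochner_Integration.integrable_bound)
  show "integrable lborel (\<lambda>t. norm (m t) * B)" using m by simp
  show "(\<lambda>t. m t * k t) \<in> borel_measurable lborel"
    using borel_measurable_integrable[OF m] k(1) by simp
  have "norm (m t * k t) \<le> norm (m t) * B" for t
    unfolding norm_mult using k(2) by (intro mult_left_mono) auto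
  then show "AE t in lborel. norm (m t * k t) \<le> norm (norm (m t) * B)"
    by (intro AE_I2) (auto intro: order_trans[OF _ abs_ge_self])
qed

definition cauchy_transform :: "(real \<Rightarrow> complex) \<Rightarrow> complex \<Rightarrow> complex" where
  "cauchy_transform m z = (LINT t|lborel. m t / (z - of_real t))"

lemma abs_Im_le_cmod_diff: "\<bar>Im z\<bar> \<le> cmod (z - of_real t)"
  using abs_Im_le_cmod[of "z - of_real t"] by simp

lemma norm_inverse_diff_of_real_le:
  assumes "\<delta> > 0" "\<delta> \<le> \<bar>Im z\<bar>"
  shows "cmod (inverse (z - of_real t)) \<le> inverse \<delta>"
  unfolding norm_inverse using assms abs_Im_le_cmod_diff[of z t]
  by (intro le_imp_inverse_le) auto

lemma cauchy_kernel_integrable: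
  assumes "integrable lborel m" "Im z \<noteq> 0"
  shows "integrable lborel (\<lambda>t. m t / (z - of_real t) ^ n)"
proof -
  have "integrable lborel (\<lambda>t. m t * inverse (z - of_real t) ^ n)"
  proof (rule integrable_mult_bounded[OF assms(1)])
    show "norm (inverse (z - of_real t) ^ n) \<le> inverse \<bar>Im z\<bar> ^ n" for t
      unfolding norm_power using assms(2) by (intro power_mono norm_inverse_diff_of_real_le) auto
  qed measurable
  then show ?thesis by (simp add: divide_inverse power_inverse)
qed

text \<open>The decay as \<open>\<bar>Im z\<bar>\<close> grows is what later forces constants to be
  0: the one from Liouville's theorem and each moment.\<close>

lemma norm_cauchy_transform_le:
  assumes m: "integrable lborel m" and z: "Im z \<noteq> 0"
  shows "cmod (cauchy_transform m z) \<le> (LINT t|lborel. cmod (m t)) / \<bar>Im z\<bar>"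
proof -
  have "cmod (cauchy_transform m z) \<le> (LINT t|lborel. cmod (m t) / \<bar>Im z\<bar>)"
    unfolding cauchy_transform_def
  proof (rule Bochner_Integration.integral_norm_bound_integral)
    show "integrable lborel (\<lambda>t. m t / (z - of_real t))"
      using cauchy_kernel_integrable[OF assms, of 1] by simp
    show "cmod (m t / (z - of_real t)) \<le> cmod (m t) / \<bar>Im z\<bar>" for t
      unfolding norm_divide using z abs_Im_le_cmod_diff[of z t]
      by (intro divide_left_mono mult_pos_pos) auto
  qed (use m in simp)
  then show ?thesis by simp
qed

text \<open>Subtracting the expected derivative from the difference quotient of the kernel leaves w
  - z divided by (w - t) times the square of z - t. With \<delta> half the distance from z to the
  real axis, both w and z stay at distance at least \<delta> from it, so the remainder is bounded
  uniformly in t by a multiple of \<open>cmod (w - z)\<close>.\<close>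

lemma cauchy_transform_deriv:
  assumes m: "integrable lborel m" and z: "Im z \<noteq> 0"
  shows "(cauchy_transform m has_field_derivative - (LINT t|lborel. m t / (z - of_real t)\<^sup>2)) (at z)"
proof -
  define \<delta> where "\<delta> = \<bar>Im z\<bar> / 2"
  define N where "N = (LINT t|lborel. cmod (m t))"
  have \<delta>: "\<delta> > 0" using z by (simp add: \<delta>_def)
  have bound: "cmod ((cauchy_transform m w - cauchy_transform m z) / (w - z) + (LINT t|lborel. m t / (z - of_real t)\<^sup>2))
      \<le> cmod (w - z) * N * inverse \<delta> ^ 3" if w: "w \<noteq> z" "cmod (w - z) < \<delta>" for w
  proof -
    have "\<bar>Im w - Im z\<bar> < \<delta>" using w(2) abs_Im_le_cmod[of "w - z"] by simp
    then have Imw: "\<delta> \<le> \<bar>Im w\<bar>" unfolding \<delta>_def by linarith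
    have Imz: "\<delta> \<le> \<bar>Im z\<bar>" using \<delta> unfolding \<delta>_def by linarith
    have nz: "w - of_real t \<noteq> 0" "z - of_real t \<noteq> 0" for t
      using abs_Im_le_cmod_diff[of w t] abs_Im_le_cmod_diff[of z t] Imw Imz \<delta> by auto
    have "cauchy_transform m w - cauchy_transform m z
        = (LINT t|lborel. m t / (w - of_real t) - m t / (z - of_real t))"
      unfolding cauchy_transform_def
      using cauchy_kernel_integrable[OF m, of w 1] cauchy_kernel_integrable[OF m, of z 1] z Imw \<delta>
      by (subst Bochner_Integration.integral_diff) auto
    then have "(cauchy_transform m w - cauchy_transform m z) / (w - z) + (LINT t|lborel. m t / (z - of_real t)\<^sup>2)
        = (LINT t|lborel. (m t / (w - of_real t) - m t / (z - of_real t)) / (w - z) + m t / (z - of_real t)\<^sup>2)"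
      using cauchy_kernel_integrable[OF m, of w 1] cauchy_kernel_integrable[OF m, of z] z Imw \<delta>
        cauchy_kernel_integrable[OF m, of z 1]
      by (subst Bochner_Integration.integral_add) auto
    also have "\<dots> = (LINT t|lborel. m t * ((w - z) * (inverse (w - of_real t) * inverse (z - of_real t) ^ 2)))"
    proof (rule Bochner_Integration.integral_cong[OF refl])
      fix t
      have "(m t / p - m t / q) / (p - q) + m t / q\<^sup>2 = m t * ((p - q) * (inverse p * inverse q ^ 2))"
        if "p \<noteq> 0" "q \<noteq> 0" "p \<noteq> q" for p q :: complex
        using that by (simp add: divide_simps power2_eq_square) (simp add: algebra_simps)
      from this[of "w - of_real t" "z - of_real t"] nz[of t] w(1)
      show "(m t / (w - of_real t) - m t / (z - of_real t)) / (w - z) + m t / (z - of_real t)\<^sup>2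
        = m t * ((w - z) * (inverse (w - of_real t) * inverse (z - of_real t) ^ 2))"
        by simp
    qed
    also have "cmod \<dots> \<le> (LINT t|lborel. cmod (m t) * (cmod (w - z) * (inverse \<delta> * inverse \<delta> ^ 2)))"
    proof (rule Bochner_Integration.integral_norm_bound_integral)
      have le: "cmod ((w - z) * (inverse (w - of_real t) * inverse (z - of_real t) ^ 2))
          \<le> cmod (w - z) * (inverse \<delta> * inverse \<delta> ^ 2)" for t
        unfolding norm_mult norm_power using \<delta> Imw Imz
        by (intro mult_left_mono mult_mono power_mono norm_inverse_diff_of_real_le) auto
      then show "integrable lborel (\<lambda>t. m t * ((w - z) * (inverse (w - of_real t) * inverse (z - of_real t) ^ 2)))"
        by (intro integrable_mult_bounded[OF m]) measurable
      show "cmod (m t * ((w - z) * (inverse (w - of_real t) * inverse (z - of_real t) ^ 2)))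
          \<le> cmod (m t) * (cmod (w - z) * (inverse \<delta> * inverse \<delta> ^ 2))" for t
        unfolding norm_mult[of "m t"] by (intro mult_left_mono le) simp
    qed (use m in simp)
    also have "\<dots> = cmod (w - z) * N * inverse \<delta> ^ 3"
      by (simp add: N_def power2_eq_square power3_eq_cube mult_ac)
    finally show ?thesis .
  qed
  have "((\<lambda>w. cmod (w - z) * N * inverse \<delta> ^ 3) \<longlongrightarrow> cmod (z - z) * N * inverse \<delta> ^ 3) (at z)"
    by (intro tendsto_intros)
  then have lim: "((\<lambda>w. cmod (w - z) * N * inverse \<delta> ^ 3) \<longlongrightarrow> 0) (at z)" by simp
  have "((\<lambda>w. (cauchy_transform m w - cauchy_transform m z) / (w - z) + (LINT t|lborel. m t / (z - of_real t)\<^sup>2)) \<longlongrightarrow> 0) (at z)"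
  proof (rule Lim_null_comparison[OF _ lim])
    show "\<forall>\<^sub>F w in at z. cmod ((cauchy_transform m w - cauchy_transform m z) / (w - z) + (LINT t|lborel. m t / (z - of_real t)\<^sup>2))
      \<le> cmod (w - z) * N * inverse \<delta> ^ 3"
      unfolding eventually_at using \<delta> bound by (auto simp: dist_norm)
  qed
  from tendsto_diff[OF this tendsto_const[of "LINT t|lborel. m t / (z - of_real t)\<^sup>2"]]
  show ?thesis by (simp add: has_field_derivative_iff)
qed

text \<open>On \<open>0 < Im z < 2h\<close> the Cauchy transform differs by a constant from the conjugate of its reflection
  in the line \<open>Im z = h\<close>; the two therefore glue to a bounded entire function.\<close>

lemma cauchy_transform_zero_if_Im_deriv_zero:
  assumes m: "integrable lborel m" and h: "h > 0" and "a < b"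
    and zero: "\<And>x. x \<in> {a<..<b} \<Longrightarrow> Im (LINT t|lborel. m t / (of_real x + \<i> * of_real h - of_real t)\<^sup>2) = 0"
    and z: "Im z > 0"
  shows "cauchy_transform m z = 0"
proof -
  define N where "N = (LINT t|lborel. cmod (m t))"
  have N: "N \<ge> 0" by (simp add: N_def)
  \<comment> \<open>The shift by h moves the line of reflection to the real axis. There
    \<open>B\<close> is the reflection of \<open>A\<close>: B z = cnj (A (cnj z)).\<close>
  define A where "A z = cauchy_transform m (z + \<i> * of_real h)" for z
  define B where "B z = cauchy_transform (\<lambda>t. cnj (m t)) (z - \<i> * of_real h)" for z
  define A' where "A' z = - (LINT t|lborel. m t / (z + \<i> * of_real h - of_real t)\<^sup>2)" for z
  define B' where "B' z = - (LINT t|lborel. cnj (m t) / (z - \<i> * of_real h - of_real t)\<^sup>2)" for z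
  define U where "U = {z. Im z > - h} \<inter> {z. Im z < h}"
  have m': "integrable lborel (\<lambda>t. cnj (m t))" using m by simp
  have A: "(A has_field_derivative A' z) (at z)" if "Im z > - h" for z
  proof -
    have "(cauchy_transform m has_field_derivative A' z) (at (z + \<i> * of_real h))"
      unfolding A'_def by (rule cauchy_transform_deriv[OF m]) (use that in simp)
    moreover have "((\<lambda>z. z + \<i> * of_real h) has_field_derivative 1) (at z)"
      by (auto intro!: derivative_eq_intros)
    ultimately have "((\<lambda>z. cauchy_transform m (z + \<i> * of_real h)) has_field_derivative A' z * 1) (at z)"
      by (rule DERIV_chain2)
    then show ?thesis unfolding A_def by simp
  qed
  have B: "(B has_field_derivative B' z) (at z)" if "Im z < h" for z
  proof -
    have "(cauchy_transform (\<lambda>t. cnj (m t)) has_field_derivative B' z) (at (z - \<i> * of_real h))"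
      unfolding B'_def by (rule cauchy_transform_deriv[OF m']) (use that in simp)
    moreover have "((\<lambda>z. z - \<i> * of_real h) has_field_derivative 1) (at z)"
      by (auto intro!: derivative_eq_intros)
    ultimately have "((\<lambda>z. cauchy_transform (\<lambda>t. cnj (m t)) (z - \<i> * of_real h)) has_field_derivative B' z * 1) (at z)"
      by (rule DERIV_chain2)
    then show ?thesis unfolding B_def by simp
  qed
  have holA: "A holomorphic_on {z. Im z > - h}"
    using A by (auto simp: holomorphic_on_open open_halfspace_Im_gt)
  have holB: "B holomorphic_on {z. Im z < h}"
    using B by (auto simp: holomorphic_on_open open_halfspace_Im_lt)
  have U: "open U" "convex U"
    unfolding U_def
    by (intro open_Int convex_Int open_halfspace_Im_gt open_halfspace_Im_lt convex_halfspace_Im_gt convex_halfspace_Im_lt)+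
  have D: "((\<lambda>z. A z - B z) has_field_derivative A' z - B' z) (at z)" if "z \<in> U" for z
    using that A B by (auto simp: U_def intro!: derivative_intros)
  have "(\<lambda>z. A z - B z) holomorphic_on U"
    using holA holB by (auto simp: U_def intro!: holomorphic_intros intro: holomorphic_on_subset)
  then have "deriv (\<lambda>z. A z - B z) holomorphic_on U"
    using U(1) by (rule holomorphic_deriv)
  then have hol': "(\<lambda>z. A' z - B' z) holomorphic_on U"
    by (rule holomorphic_transform) (use D in \<open>auto intro: DERIV_imp_deriv\<close>)
  \<comment> \<open>On the real axis B' is the conjugate of A', and the hypothesis says that A' is
    real on the segment.\<close>
  have real: "A' (of_real x) - B' (of_real x) = 0" if "x \<in> {a<..<b}" for x
  proof -
    have "(LINT t|lborel. cnj (m t) / (of_real x - \<i> * of_real h - of_real t)\<^sup>2)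
        = (LINT t|lborel. cnj (m t / (of_real x + \<i> * of_real h - of_real t)\<^sup>2))"
      by (rule Bochner_Integration.integral_cong) simp_all
    also have "\<dots> = cnj (LINT t|lborel. m t / (of_real x + \<i> * of_real h - of_real t)\<^sup>2)"
      by (rule Bochner_Integration.integral_cnj)
    finally have "B' (of_real x) = cnj (A' (of_real x))"
      unfolding A'_def B'_def complex_cnj_minus by (rule arg_cong)
    then show ?thesis using zero[OF that] by (simp add: A'_def complex_eq_iff)
  qed
  \<comment> \<open>Identity theorem on the strip: the zeros fill a real segment, which accumulates
    at its midpoint.\<close>
  have zero': "A' z - B' z = 0" if "z \<in> U" for z
  proof (rule analytic_continuation[OF hol' U(1) convex_connected[OF U(2)]])
    show "of_real ` {a<..<b} \<subseteq> U" using h by (auto simp: U_def)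
    show "of_real ((a + b) / 2) \<in> U" using h by (simp add: U_def)
    have "(a + b) / 2 islimpt {a<..<b}"
      using \<open>a < b\<close> by (intro interior_limit_point) (simp add: interior_open field_simps)
    then show "(of_real ((a + b) / 2) :: complex) islimpt of_real ` {a<..<b}"
      unfolding islimpt_approachable by (fastforce simp: dist_of_real simp del: of_real_divide of_real_add)
  qed (use real that in auto)
  have "\<exists>c. \<forall>z\<in>U. A z - B z = c"
    using D zero' by (intro has_field_derivative_zero_constant[OF U(2)])
      (metis has_field_derivative_at_within)
  then obtain c where c: "\<And>z. z \<in> U \<Longrightarrow> A z = B z + c" by (auto simp: algebra_simps)
  define E where "E z = (if z \<in> {z. Im z > - h} then A z else B z + c)" for z
  have "E holomorphic_on ({z. Im z > - h} \<union> {z. Im z < h})"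
    unfolding E_def using c
    by (intro holomorphic_on_If_Un holA holomorphic_intros holB open_halfspace_Im_gt open_halfspace_Im_lt)
      (auto simp: U_def)
  moreover have "{z. Im z > - h} \<union> {z. Im z < h} = UNIV" using h by auto
  ultimately have holE: "E holomorphic_on UNIV" by simp
  \<comment> \<open>The bound of \<open>A\<close> blows up towards Im z = - h, so \<open>A\<close>
    is used only for Im z \<ge> 0 and B + c below. Either way the transform is evaluated at distance
    at least h from the real axis; in the lower part of the strip the two expressions agree.\<close>
  have "cmod (E z) \<le> N / h + cmod c" for z
  proof (cases "Im z \<ge> 0")
    case True
    have "cmod (A z) \<le> N / \<bar>Im (z + \<i> * of_real h)\<bar>"
      unfolding A_def N_def using True h by (intro norm_cauchy_transform_le[OF m]) auto
    also have "\<dots> \<le> N / h" using True h N by (intro divide_left_mono) auto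
    finally have "cmod (A z) \<le> N / h + cmod c" using norm_ge_zero[of c] by linarith
    then show ?thesis using True h by (simp add: E_def)
  next
    case False
    have "cmod (B z) \<le> (LINT t|lborel. cmod (cnj (m t))) / \<bar>Im (z - \<i> * of_real h)\<bar>"
      unfolding B_def using False h by (intro norm_cauchy_transform_le[OF m']) auto
    also have "\<dots> \<le> N / h" unfolding N_def[symmetric] complex_mod_cnj
      using False h N by (intro divide_left_mono) auto
    finally have "cmod (B z + c) \<le> N / h + cmod c"
      by (intro order_trans[OF norm_triangle_ineq]) simp
    moreover have "E z = B z + c" using c[of z] False h by (auto simp: E_def U_def)
    ultimately show ?thesis by simp
  qed
  then have "bounded (range E)" by (auto simp: bounded_iff)
  with holE have "E constant_on UNIV" by (rule Liouville_theorem)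
  then obtain k where k: "\<And>z. E z = k" by (auto simp: constant_on_def)
  \<comment> \<open>The constant from Liouville's theorem is the value of \<open>A\<close> at every
    point of the positive imaginary axis, where \<open>A\<close> decays.\<close>
  have "cmod k \<le> N / y" if "y > 0" for y
  proof -
    have "cmod (A (\<i> * of_real y)) \<le> N / \<bar>Im (\<i> * of_real y + \<i> * of_real h)\<bar>"
      unfolding A_def N_def using that h by (intro norm_cauchy_transform_le[OF m]) auto
    also have "\<dots> \<le> N / y" using that h N by (intro divide_left_mono) auto
    finally show ?thesis using k[of "\<i> * of_real y"] that h by (simp add: E_def)
  qed
  note kle = this
  have "cmod k \<le> 0"
  proof (rule field_le_epsilon)
    fix e :: real assume "e > 0"
    \<comment> \<open>The height (N + 1) / e is positive even when N = 0.\<close>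
    then have "N / ((N + 1) / e) \<le> e" using N by (simp add: field_simps)
    then show "cmod k \<le> 0 + e" using kle[of "(N + 1) / e"] N \<open>e > 0\<close> by simp
  qed
  \<comment> \<open>For Im z > 0 the shifted point has imaginary part above - h, where
    \<open>E\<close> is \<open>A\<close> by definition.\<close>
  then have "A (z - \<i> * of_real h) = 0"
    using k[of "z - \<i> * of_real h"] z by (simp add: E_def)
  then show ?thesis by (simp add: A_def)
qed

text \<open>The step multiplies the density by \<open>t\<close>: from \<open>t / (z - t) = z / (z - t) - 1\<close> the transform of
  \<open>t\<^sup>n\<^sup>+\<^sup>1 m\<close> is a constant, which vanishes as \<open>Im z \<rightarrow> \<infinity>\<close>.\<close>

lemma moments_zero_if_cauchy_transform_zero:
  assumes m: "integrable lborel m" and supp: "\<And>t. m t \<noteq> 0 \<Longrightarrow> \<bar>t\<bar> \<le> R"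
    and zero: "\<And>z. Im z > 0 \<Longrightarrow> cauchy_transform m z = 0"
  shows "(LINT t|lborel. m t * of_real t ^ n) = 0"
proof -
  have int: "integrable lborel (\<lambda>t. m t * of_real t ^ n)" for n
  proof -
    \<comment> \<open>Clamping t to [- R, R] makes the power a bounded factor and leaves the product
      unchanged, as m vanishes where the clamp acts.\<close>
    have "integrable lborel (\<lambda>t. m t * (of_real (max (- R) (min R t)) ^ n))"
    proof (rule integrable_mult_bounded[OF m])
      show "norm ((of_real (max (- R) (min R t)) :: complex) ^ n) \<le> \<bar>R\<bar> ^ n" for t
        unfolding norm_power by (intro power_mono) auto
    qed measurable
    moreover have "m t * (of_real (max (- R) (min R t)) ^ n) = m t * of_real t ^ n" for t
    proof (cases "m t = 0")
      case False
      then have "max (- R) (min R t) = t" using supp[of t] by auto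
      then show ?thesis by simp
    qed simp
    ultimately show ?thesis by simp
  qed
  have step: "(LINT t|lborel. m t * of_real t ^ n) = 0 \<and>
      (\<forall>z. Im z > 0 \<longrightarrow> cauchy_transform (\<lambda>t. m t * of_real t ^ Suc n) z = 0)"
    if IH: "\<And>z. Im z > 0 \<Longrightarrow> cauchy_transform (\<lambda>t. m t * of_real t ^ n) z = 0" for n
  proof -
    define I where "I = (LINT t|lborel. m t * of_real t ^ n)"
    define N where "N = (LINT t|lborel. cmod (m t * of_real t ^ Suc n))"
    have N: "N \<ge> 0" by (simp add: N_def)
    have eq: "cauchy_transform (\<lambda>t. m t * of_real t ^ Suc n) z = - I" if z: "Im z > 0" for z
    proof -
      have "m t * of_real t ^ Suc n / (z - of_real t) = z * (m t * of_real t ^ n / (z - of_real t)) - m t * of_real t ^ n" for t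
      proof -
        have "z - of_real t \<noteq> 0" using z by (auto simp: complex_eq_iff)
        then show ?thesis by (simp add: field_simps)
      qed
      then have "cauchy_transform (\<lambda>t. m t * of_real t ^ Suc n) z
          = (LINT t|lborel. z * (m t * of_real t ^ n / (z - of_real t)) - m t * of_real t ^ n)"
        unfolding cauchy_transform_def by simp
      also have "\<dots> = (LINT t|lborel. z * (m t * of_real t ^ n / (z - of_real t))) - I"
        unfolding I_def using int[of n] cauchy_kernel_integrable[OF int[of n], of z 1] z
        by (intro Bochner_Integration.integral_diff integrable_mult_right) auto
      also have "\<dots> = z * cauchy_transform (\<lambda>t. m t * of_real t ^ n) z - I"
        by (simp only: cauchy_transform_def integral_mult_right_zero)
      finally show ?thesis using IH[OF z] by simp
    qed
    have le: "cmod I \<le> N / y" if "y > 0" for y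
      using norm_cauchy_transform_le[OF int[of "Suc n"], of "\<i> * of_real y"] eq[of "\<i> * of_real y"] that
      by (simp add: N_def)
    have "cmod I \<le> 0"
    proof (rule field_le_epsilon)
      fix e :: real assume "e > 0"
      then have "N / ((N + 1) / e) \<le> e" using N by (simp add: field_simps)
      then show "cmod I \<le> 0 + e" using le[of "(N + 1) / e"] N \<open>e > 0\<close> by simp
    qed
    then show ?thesis using eq by (simp add: I_def)
  qed
  have "\<forall>z. Im z > 0 \<longrightarrow> cauchy_transform (\<lambda>t. m t * of_real t ^ n) z = 0"
  proof (induction n)
    case 0
    then show ?case using zero by simp
  next
    case (Suc n)
    then show ?case using step[of n] by blast
  qed
  then show ?thesis using step by blast
qed

text \<open>By Stone-Weierstrass, polynomials approximate a test function uniformly on [a, b].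
  Integrals of f against polynomials vanish, hence so do those against test functions, and the
  fundamental lemma applies.\<close>

lemma AE_zero_if_moments_zero:
  fixes f :: "real \<Rightarrow> real"
  assumes f: "set_integrable lborel {a<..<b} f"
    and mom: "\<And>n. (LINT t:{a<..<b}|lborel. f t * t ^ n) = 0"
  shows "AE x in lborel. x \<in> {a<..<b} \<longrightarrow> f x = 0"
proof (rule fundamental_lemma_test_functions[OF f])
  fix \<eta> assume \<eta>: "\<eta> \<in> test_functions {a<..<b}"
  let ?S = "{a<..<b}"
  define N where "N = (LINT t:?S|lborel. \<bar>f t\<bar>)"
  have N: "N \<ge> 0" by (simp add: N_def set_lebesgue_integral_def)
  have int: "set_integrable lborel ?S (\<lambda>t. f t * p t)" if p: "continuous_on UNIV p" for p
  proof -
    have "bounded (p ` {a..b})"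
      using p by (intro compact_imp_bounded compact_continuous_image) (auto intro: continuous_on_subset)
    then obtain C where C: "\<forall>t\<in>{a..b}. \<bar>p t\<bar> \<le> C" by (auto simp: bounded_iff)
    have [measurable]: "p \<in> borel_measurable borel" using p by (rule borel_measurable_continuous_onI)
    have "integrable lborel (\<lambda>t. (indicator ?S t * f t) * (indicator ?S t * p t))"
    proof (rule integrable_mult_bounded)
      show "norm (indicator ?S t * p t) \<le> \<bar>C\<bar>" for t
      proof (cases "t \<in> ?S")
        case True
        then have "\<bar>p t\<bar> \<le> C" using C by auto
        then show ?thesis using True by simp
      qed simp
    qed (use f in \<open>auto simp: set_integrable_def\<close>)
    moreover have "(indicator ?S t * f t) * (indicator ?S t * p t) = indicator ?S t *\<^sub>R (f t * p t)" for t
      by (simp add: indicator_def)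
    ultimately show ?thesis by (simp add: set_integrable_def)
  qed
  have "\<bar>LINT t:?S|lborel. f t * \<eta> t\<bar> \<le> 0 + e" if e: "e > 0" for e
  proof -
    \<comment> \<open>The error is at most N * d; dividing by N + 1 instead of N also covers N =
      0.\<close>
    define d where "d = e / (N + 1)"
    have d: "d > 0" using e N by (simp add: d_def)
    obtain p where p: "real_polynomial_function p" "\<And>t. t \<in> {a..b} \<Longrightarrow> \<bar>\<eta> t - p t\<bar> < d"
      using Stone_Weierstrass_real_polynomial_function[of "{a..b}" \<eta> d]
        test_function_properties(2)[OF \<eta>] d by (auto intro: continuous_on_subset)
    obtain c n where c: "p = (\<lambda>t. \<Sum>i\<le>n. c i * t ^ i)"
      using p(1) by (auto simp: real_polynomial_function_iff_sum)
    have contp: "continuous_on UNIV p" unfolding c by (intro continuous_intros)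
    have "(LINT t:?S|lborel. f t * p t) = (LINT t:?S|lborel. (\<Sum>i\<le>n. c i * (f t * t ^ i)))"
      by (simp add: c sum_distrib_left mult_ac)
    also have "\<dots> = (\<Sum>i\<le>n. (LINT t:?S|lborel. c i * (f t * t ^ i)))"
      unfolding set_lebesgue_integral_def scaleR_sum_right
    proof (rule Bochner_Integration.integral_sum)
      show "integrable lborel (\<lambda>t. indicator ?S t *\<^sub>R (c i * (f t * t ^ i)))" for i
        using set_integrable_mult_right[OF int[of "\<lambda>t. t ^ i"], of "c i"]
        by (simp add: set_integrable_def continuous_intros)
    qed
    also have "\<dots> = 0" using mom by simp
    finally have p0: "(LINT t:?S|lborel. f t * p t) = 0" .
    have "(LINT t:?S|lborel. f t * \<eta> t) = (LINT t:?S|lborel. f t * \<eta> t - f t * p t)"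
      using int[OF contp] int[OF test_function_properties(2)[OF \<eta>]] p0 by (subst set_integral_diff) auto
    also have "\<bar>\<dots>\<bar> \<le> (LINT t:?S|lborel. \<bar>f t\<bar> * d)"
      unfolding set_lebesgue_integral_def real_norm_def[symmetric]
    proof (rule Bochner_Integration.integral_norm_bound_integral)
      show "integrable lborel (\<lambda>t. indicator ?S t *\<^sub>R (f t * \<eta> t - f t * p t))"
        using set_integral_diff(1)[OF int[OF test_function_properties(2)[OF \<eta>]] int[OF contp]]
        by (simp add: set_integrable_def)
      show "integrable lborel (\<lambda>t. indicator ?S t *\<^sub>R (norm (f t) * d))"
        using set_integrable_mult_left[OF set_integrable_abs[OF f], of d] by (simp add: set_integrable_def)
      show "norm (indicator ?S t *\<^sub>R (f t * \<eta> t - f t * p t)) \<le> indicator ?S t *\<^sub>R (norm (f t) * d)" for t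
        using p(2)[of t]
        by (auto simp: indicator_def abs_mult simp flip: right_diff_distrib intro!: mult_left_mono)
    qed
    also have "\<dots> = N * d" by (simp add: N_def)
    also have "\<dots> \<le> e" using N e by (simp add: d_def field_simps)
    finally show ?thesis by simp
  qed
  then have "\<bar>LINT t:?S|lborel. f t * \<eta> t\<bar> \<le> 0" by (rule field_le_epsilon)
  then show "(LINT t:?S|lborel. f t * \<eta> t) = 0" by simp
qed

section \<open>The operators \<open>b\<^sub>2\<close> and \<open>b\<^sub>2\<^sup>*\<close>\<close>

text \<open>The u-derivative of \<open>P\<^sub>h + i Q\<^sub>h\<close>, so that its real and
  imaginary parts are the two convolution kernels of \<open>b2_adj\<close>.\<close>

definition deriv_kernel :: "real \<Rightarrow> real \<Rightarrow> complex" where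
  "deriv_kernel h u = - (\<i> / of_real pi) / (of_real u + \<i> * of_real h)\<^sup>2"

lemma poisson_kernels_eq:
  shows "poisson h u = Re ((\<i> / of_real pi) / (of_real u + \<i> * of_real h))"
    and "conj_poisson h u = Im ((\<i> / of_real pi) / (of_real u + \<i> * of_real h))"
proof -
  have eq: "(\<i> / of_real pi) / (of_real u + \<i> * of_real h) = of_real (1 / pi) * (\<i> / (of_real u + \<i> * of_real h))"
    by simp
  show "poisson h u = Re ((\<i> / of_real pi) / (of_real u + \<i> * of_real h))"
    "conj_poisson h u = Im ((\<i> / of_real pi) / (of_real u + \<i> * of_real h))"
    unfolding eq scaleR_conv_of_real[symmetric] scaleR_complex.sel
    by (simp_all add: poisson_def conj_poisson_def Re_divide Im_divide)
qed

text \<open>The Poisson kernel is even and its conjugate is odd, so their derivatives are odd and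
  even. Transposing a convolution therefore changes the sign of the real part only, which accounts
  for the signs relating \<open>b2\<close> and \<open>b2_adj\<close>.\<close>

lemma deriv_kernel_minus:
  assumes "h > 0"
  shows "deriv_kernel h (- u) = - cnj (deriv_kernel h u)"
proof -
  have "(of_real (- u) + \<i> * of_real h)\<^sup>2 = (cnj (of_real u + \<i> * of_real h))\<^sup>2"
    by (simp add: power2_eq_square algebra_simps)
  then show ?thesis by (simp add: deriv_kernel_def)
qed

lemma deriv_kernel_continuous:
  assumes "h > 0"
  shows "continuous_on UNIV (deriv_kernel h)"
proof -
  have "of_real u + \<i> * of_real h \<noteq> 0" for u using assms by (auto simp: complex_eq_iff)
  then show ?thesis unfolding deriv_kernel_def by (intro continuous_intros) auto
qed

lemma norm_deriv_kernel_le: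
  assumes "h > 0"
  shows "cmod (deriv_kernel h u) \<le> 1 / (pi * h\<^sup>2)"
proof -
  have "h \<le> cmod (of_real u + \<i> * of_real h)"
    using abs_Im_le_cmod[of "of_real u + \<i> * of_real h"] assms by simp
  then have "h\<^sup>2 \<le> (cmod (of_real u + \<i> * of_real h))\<^sup>2"
    using assms by (intro power_mono) auto
  then have "1 / (pi * (cmod (of_real u + \<i> * of_real h))\<^sup>2) \<le> 1 / (pi * h\<^sup>2)"
    using assms by (intro divide_left_mono mult_left_mono mult_pos_pos) (auto intro: less_le_trans)
  then show ?thesis
    by (simp add: deriv_kernel_def norm_divide norm_mult norm_power)
qed

lemma Re_Im_deriv_kernel:
  assumes "h > 0"
  shows "continuous_on UNIV (\<lambda>u. Re (deriv_kernel h u))" "\<bar>Re (deriv_kernel h u)\<bar> \<le> 1 / (pi * h\<^sup>2)"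
    and "continuous_on UNIV (\<lambda>u. Im (deriv_kernel h u))" "\<bar>Im (deriv_kernel h u)\<bar> \<le> 1 / (pi * h\<^sup>2)"
  using deriv_kernel_continuous[OF assms] norm_deriv_kernel_le[OF assms, of u]
    abs_Re_le_cmod[of "deriv_kernel h u"] abs_Im_le_cmod[of "deriv_kernel h u"]
  by (auto intro: continuous_intros order_trans)

section \<open>Convolution with bounded continuous kernels\<close>

lemma convol_integrable:
  fixes \<kappa> f :: "real \<Rightarrow> real"
  assumes \<kappa>: "continuous_on UNIV \<kappa>" "\<And>u. \<bar>\<kappa> u\<bar> \<le> B" and f: "integrable lborel f"
  shows "integrable lborel (\<lambda>t. \<kappa> (x - t) * f t)"
proof -
  have [measurable]: "\<kappa> \<in> borel_measurable borel"
    using \<kappa>(1) by (rule borel_measurable_continuous_onI)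
  have "integrable lborel (\<lambda>t. f t * \<kappa> (x - t))"
    using \<kappa>(2) by (intro integrable_mult_bounded[OF f]) auto
  then show ?thesis by (simp add: mult.commute)
qed

lemma convol_lin:
  assumes \<kappa>: "continuous_on UNIV \<kappa>" "\<And>u. \<bar>\<kappa> u\<bar> \<le> B"
    and f: "integrable lborel f" and g: "integrable lborel g"
  shows "convol \<kappa> (\<lambda>t. s * f t + r * g t) x = s * convol \<kappa> f x + r * convol \<kappa> g x"
proof -
  have "convol \<kappa> (\<lambda>t. s * f t + r * g t) x = (LINT t|lborel. s * (\<kappa> (x - t) * f t) + r * (\<kappa> (x - t) * g t))"
    by (simp add: convol_def algebra_simps)
  also have "\<dots> = (LINT t|lborel. s * (\<kappa> (x - t) * f t)) + (LINT t|lborel. r * (\<kappa> (x - t) * g t))"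
    by (intro Bochner_Integration.integral_add integrable_mult_right convol_integrable[OF \<kappa>] f g)
  finally show ?thesis by (simp add: convol_def)
qed

lemma convol_continuous:
  assumes \<kappa>: "continuous_on UNIV \<kappa>" "\<And>u. \<bar>\<kappa> u\<bar> \<le> B" and f: "integrable lborel f"
  shows "continuous_on UNIV (convol \<kappa> f)"
proof (rule continuous_on_sequentiallyI)
  fix u :: "nat \<Rightarrow> real" and a assume u: "u \<longlonglongrightarrow> a"
  note [measurable] = borel_measurable_continuous_onI[OF \<kappa>(1)] borel_measurable_integrable[OF f]
  show "(\<lambda>n. convol \<kappa> f (u n)) \<longlonglongrightarrow> convol \<kappa> f a"
    unfolding convol_def
  proof (rule integral_dominated_convergence[where w = "\<lambda>t. B * norm (f t)"])
    have "isCont \<kappa> y" for y using \<kappa>(1) by (simp add: continuous_on_eq_continuous_at)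
    then have "(\<lambda>n. \<kappa> (u n - t)) \<longlonglongrightarrow> \<kappa> (a - t)" for t
      by (intro isCont_tendsto_compose[of _ \<kappa>] tendsto_intros u) auto
    then show "AE t in lborel. (\<lambda>n. \<kappa> (u n - t) * f t) \<longlonglongrightarrow> \<kappa> (a - t) * f t"
      by (intro AE_I2 tendsto_intros)
    show "AE t in lborel. norm (\<kappa> (u n - t) * f t) \<le> B * norm (f t)" for n
      using \<kappa>(2) by (intro AE_I2) (auto simp: abs_mult intro!: mult_right_mono)
  qed (use f in auto)
qed

text \<open>Fubini's theorem; it applies because a bounded kernel makes the double integral of
  absolute values at most B times the product of the two \<open>L\<^sup>1\<close> norms.\<close>

lemma convol_adjoint:
  assumes \<kappa>: "continuous_on UNIV \<kappa>" "\<And>u. \<bar>\<kappa> u\<bar> \<le> B"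
    and f: "integrable lborel f" and g: "integrable lborel g"
  shows "(LINT x|lborel. convol \<kappa> f x * g x) = (LINT t|lborel. f t * convol (\<lambda>u. \<kappa> (- u)) g t)"
proof -
  note [measurable] = borel_measurable_continuous_onI[OF \<kappa>(1)] borel_measurable_integrable[OF f]
    borel_measurable_integrable[OF g]
  define F where "F t x = \<kappa> (x - t) * f t * g x" for t x
  have F: "F t x = f t * (g x * \<kappa> (x - t))" for t x by (simp add: F_def mult_ac)
  have intg: "integrable lborel (\<lambda>x. g x * \<kappa> (x - t))" for t
    using \<kappa>(2) by (intro integrable_mult_bounded[OF g]) auto
  have B: "B \<ge> 0" using \<kappa>(2)[of 0] by linarith
  have "integrable (lborel \<Otimes>\<^sub>M lborel) (case_prod F)"
  proof (rule lborel_pair.Fubini_integrable)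
    show "case_prod F \<in> borel_measurable (lborel \<Otimes>\<^sub>M lborel)"
      unfolding F_def by measurable
    show "AE t in lborel. integrable lborel (\<lambda>x. case_prod F (t, x))"
      using intg by (intro AE_I2) (simp add: F)
    show "integrable lborel (\<lambda>t. LINT x|lborel. norm (case_prod F (t, x)))"
    proof (rule Bochner_Integration.integrable_bound)
      show "integrable lborel (\<lambda>t. \<bar>f t\<bar> * (B * (LINT x|lborel. \<bar>g x\<bar>)))" using f by simp
      show "(\<lambda>t. LINT x|lborel. norm (case_prod F (t, x))) \<in> borel_measurable lborel"
        unfolding F_def by measurable
      have "(LINT x|lborel. \<bar>g x * \<kappa> (x - t)\<bar>) \<le> (LINT x|lborel. B * \<bar>g x\<bar>)" for t
      proof (rule integral_mono)
        show "integrable lborel (\<lambda>x. \<bar>g x * \<kappa> (x - t)\<bar>)" using intg by (rule integrable_abs)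
        show "\<bar>g x * \<kappa> (x - t)\<bar> \<le> B * \<bar>g x\<bar>" for x
          unfolding abs_mult mult.commute[of B] using \<kappa>(2) by (intro mult_left_mono) auto
      qed (use g in simp)
      then have "\<bar>f t\<bar> * (LINT x|lborel. \<bar>g x * \<kappa> (x - t)\<bar>) \<le> \<bar>f t\<bar> * (B * (LINT x|lborel. \<bar>g x\<bar>))" for t
        by (intro mult_left_mono) auto
      then show "AE t in lborel. norm (LINT x|lborel. norm (case_prod F (t, x)))
          \<le> norm (\<bar>f t\<bar> * (B * (LINT x|lborel. \<bar>g x\<bar>)))"
        using B by (intro AE_I2) (simp add: F abs_mult)
    qed
  qed
  then have "(LINT x|lborel. LINT t|lborel. F t x) = (LINT t|lborel. LINT x|lborel. F t x)"
    by (rule lborel_pair.Fubini_integral)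
  moreover have "(LINT t|lborel. F t x) = convol \<kappa> f x * g x" for x
    by (simp add: F_def convol_def)
  moreover have "(LINT x|lborel. F t x) = f t * convol (\<lambda>u. \<kappa> (- u)) g t" for t
    by (simp add: F convol_def mult.commute[of "g _"])
  ultimately show ?thesis by simp
qed

text \<open>For real f, the two convolutions are the real and imaginary parts of \<i> / pi times the
  Cauchy transform of f on the line Im z = h. Restricting its complex derivative to that line yields
  both real derivatives at once.\<close>

lemma convol_poisson_deriv:
  assumes h: "h > 0" and f: "integrable lborel f"
  shows "(convol (poisson h) f has_real_derivative convol (\<lambda>u. Re (deriv_kernel h u)) f x) (at x)"
    and "(convol (conj_poisson h) f has_real_derivative convol (\<lambda>u. Im (deriv_kernel h u)) f x) (at x)"
proof -
  define m where "m t = complex_of_real (f t)" for t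
  have m: "integrable lborel m" using f by (simp add: m_def[abs_def])
  define z where "z x = of_real x + \<i> * of_real h" for x
  have z: "Im (z x) \<noteq> 0" for x using h by (simp add: z_def)
  define G where "G x = (\<i> / of_real pi) * cauchy_transform m (z x)" for x
  define G' where "G' = (\<i> / of_real pi) * (- (LINT t|lborel. m t / (z x - of_real t)\<^sup>2))"
  have "(cauchy_transform m has_field_derivative - (LINT t|lborel. m t / (z x - of_real t)\<^sup>2)) (at (of_real x + \<i> * of_real h))"
    using cauchy_transform_deriv[OF m z] by (simp add: z_def)
  moreover have "((\<lambda>w. w + \<i> * of_real h) has_field_derivative 1) (at (of_real x))"
    by (auto intro!: derivative_eq_intros)
  ultimately have "((\<lambda>w. cauchy_transform m (w + \<i> * of_real h)) has_field_derivative - (LINT t|lborel. m t / (z x - of_real t)\<^sup>2) * 1) (at (of_real x))"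
    by (rule DERIV_chain2)
  then have "((\<lambda>w. (\<i> / of_real pi) * cauchy_transform m (w + \<i> * of_real h)) has_field_derivative G') (at (of_real x))"
    unfolding G'_def by (intro DERIV_cmult) simp
  then have "(G has_vector_derivative G') (at x)"
    unfolding G_def[abs_def] z_def by (rule has_vector_derivative_real_field)
  then have deriv: "((\<lambda>x. Re (G x)) has_vector_derivative Re G') (at x)" "((\<lambda>x. Im (G x)) has_vector_derivative Im G') (at x)"
    by (auto intro: bounded_linear.has_vector_derivative[OF bounded_linear_Re]
        bounded_linear.has_vector_derivative[OF bounded_linear_Im])
  have kernel: "(\<i> / of_real pi) * (m t / (z x - of_real t)) = of_real (f t) * ((\<i> / of_real pi) / (of_real (x - t) + \<i> * of_real h))" for x t
    by (simp add: m_def z_def algebra_simps)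
  have G_eq: "G x = (LINT t|lborel. of_real (f t) * ((\<i> / of_real pi) / (of_real (x - t) + \<i> * of_real h)))" for x
    by (simp only: G_def cauchy_transform_def integral_mult_right_zero flip: kernel)
  have int: "integrable lborel (\<lambda>t. of_real (f t) * ((\<i> / of_real pi) / (of_real (x - t) + \<i> * of_real h)))" for x
    unfolding kernel[symmetric]
    using integrable_mult_right[OF cauchy_kernel_integrable[OF m z, of x 1], of "\<i> / of_real pi"] by simp
  have ReG: "Re (G x) = convol (poisson h) f x" and ImG: "Im (G x) = convol (conj_poisson h) f x" for x
    unfolding G_eq Bochner_Integration.integral_Re[OF int, symmetric] Bochner_Integration.integral_Im[OF int, symmetric]
    unfolding convol_def poisson_kernels_eq scaleR_conv_of_real[symmetric] scaleR_complex.sel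
    by (simp_all only: mult.commute)
  have kernel': "(\<i> / of_real pi) * (- (m t / (z x - of_real t)\<^sup>2)) = of_real (f t) * deriv_kernel h (x - t)" for t
    by (simp add: m_def z_def deriv_kernel_def algebra_simps)
  have G'_eq: "G' = (LINT t|lborel. of_real (f t) * deriv_kernel h (x - t))"
    by (simp only: G'_def integral_mult_right_zero Bochner_Integration.integral_minus flip: kernel')
  have int': "integrable lborel (\<lambda>t. of_real (f t) * deriv_kernel h (x - t))"
    unfolding kernel'[symmetric]
    by (intro integrable_mult_right integrable_minus cauchy_kernel_integrable[OF m z])
  have "Re G' = convol (\<lambda>u. Re (deriv_kernel h u)) f x" "Im G' = convol (\<lambda>u. Im (deriv_kernel h u)) f x"
    unfolding G'_eq Bochner_Integration.integral_Re[OF int', symmetric] Bochner_Integration.integral_Im[OF int', symmetric]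
    unfolding convol_def scaleR_conv_of_real[symmetric] scaleR_complex.sel
    by (simp_all only: mult.commute)
  then show "(convol (poisson h) f has_real_derivative convol (\<lambda>u. Re (deriv_kernel h u)) f x) (at x)"
    "(convol (conj_poisson h) f has_real_derivative convol (\<lambda>u. Im (deriv_kernel h u)) f x) (at x)"
    using deriv by (simp_all add: ReG ImG has_real_derivative_iff_has_vector_derivative)
qed

section \<open>Kernel form of the operators and their adjointness\<close>

lemma ext0_integrable:
  assumes "f \<in> L2 {a<..<b}"
  shows "integrable lborel (ext0 {a<..<b} f)"
proof -
  have "ext0 {a<..<b} f = (\<lambda>x. indicator {a<..<b} x *\<^sub>R f x)"
    by (auto simp: ext0_def indicator_def)
  then show ?thesis
    using L2_set_integrable[OF assms] by (simp add: set_integrable_def)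
qed

lemma ext0_lin: "ext0 A (\<lambda>x. s * f x + t * g x) = (\<lambda>x. s * ext0 A f x + t * ext0 A g x)"
  by (auto simp: ext0_def)

lemma L2_inner_ext0: "L2_inner A f g = (LINT x|lborel. f x * ext0 A g x)"
  unfolding L2_inner_def set_lebesgue_integral_def
  by (intro Bochner_Integration.integral_cong) (auto simp: ext0_def indicator_def)

lemma L2_inner_ext0_left: "L2_inner A f g = (LINT x|lborel. ext0 A f x * g x)"
  by (subst L2_inner_commute) (simp add: L2_inner_ext0 mult.commute)

lemma b2_adj_eq:
  assumes "h > 0" "\<phi> \<in> L2 {a<..<b}"
  shows "b2_adj {a<..<b} h \<phi> = (convol (\<lambda>u. Re (deriv_kernel h u)) (ext0 {a<..<b} \<phi>),
      convol (\<lambda>u. Im (deriv_kernel h u)) (ext0 {a<..<b} \<phi>))"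
  using convol_poisson_deriv[OF assms(1) ext0_integrable[OF assms(2)]]
  by (auto simp: b2_adj_def intro: DERIV_imp_deriv)

lemma b2_eq:
  assumes "h > 0" "m \<in> L2v {c<..<d}"
  shows "b2 {c<..<d} h m = (\<lambda>x. convol (\<lambda>u. Im (deriv_kernel h u)) (ext0 {c<..<d} (snd m)) x
      - convol (\<lambda>u. Re (deriv_kernel h u)) (ext0 {c<..<d} (fst m)) x)"
proof
  fix x
  have m: "fst m \<in> L2 {c<..<d}" "snd m \<in> L2 {c<..<d}" using assms(2) by (auto simp: L2v_def)
  have "((\<lambda>z. convol (poisson h) (ext0 {c<..<d} (fst m)) z - convol (conj_poisson h) (ext0 {c<..<d} (snd m)) z)
      has_real_derivative convol (\<lambda>u. Re (deriv_kernel h u)) (ext0 {c<..<d} (fst m)) x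
        - convol (\<lambda>u. Im (deriv_kernel h u)) (ext0 {c<..<d} (snd m)) x) (at x)"
    using m assms(1) by (intro DERIV_diff convol_poisson_deriv ext0_integrable)
  then show "b2 {c<..<d} h m x = convol (\<lambda>u. Im (deriv_kernel h u)) (ext0 {c<..<d} (snd m)) x
      - convol (\<lambda>u. Re (deriv_kernel h u)) (ext0 {c<..<d} (fst m)) x"
    by (simp add: b2_def DERIV_imp_deriv)
qed

lemma b2_adj_continuous:
  assumes "h > 0" "\<phi> \<in> L2 {a<..<b}"
  shows "continuous_on UNIV (fst (b2_adj {a<..<b} h \<phi>))" "continuous_on UNIV (snd (b2_adj {a<..<b} h \<phi>))"
  unfolding b2_adj_eq[OF assms] fst_conv snd_conv
  by (rule convol_continuous[OF _ _ ext0_integrable[OF assms(2)]], rule Re_Im_deriv_kernel[OF assms(1)],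
      rule Re_Im_deriv_kernel[OF assms(1)])+

lemma b2_adj_L2v:
  assumes "h > 0" "\<phi> \<in> L2 {a<..<b}"
  shows "b2_adj {a<..<b} h \<phi> \<in> L2v {c<..<d}"
  using b2_adj_continuous[OF assms] by (auto simp: L2v_def mem_Times_iff intro!: continuous_L2)

lemma b2_continuous:
  assumes "h > 0" "m \<in> L2v {c<..<d}"
  shows "continuous_on UNIV (b2 {c<..<d} h m)"
proof -
  have m: "fst m \<in> L2 {c<..<d}" "snd m \<in> L2 {c<..<d}" using assms(2) by (auto simp: L2v_def)
  have "continuous_on UNIV (convol (\<lambda>u. Im (deriv_kernel h u)) (ext0 {c<..<d} (snd m)))"
    by (rule convol_continuous[OF _ _ ext0_integrable[OF m(2)]]) (rule Re_Im_deriv_kernel[OF assms(1)])+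
  moreover have "continuous_on UNIV (convol (\<lambda>u. Re (deriv_kernel h u)) (ext0 {c<..<d} (fst m)))"
    by (rule convol_continuous[OF _ _ ext0_integrable[OF m(1)]]) (rule Re_Im_deriv_kernel[OF assms(1)])+
  ultimately show ?thesis unfolding b2_eq[OF assms] by (intro continuous_intros)
qed

text \<open>Moving the odd kernel (real part) across the inner product costs a sign, which cancels
  the minus sign of the Poisson term in \<open>b2\<close>; the even kernel (imaginary part) moves
  across freely and already carries a plus sign.\<close>

lemma b2_adjoint:
  assumes h: "h > 0" and m: "m \<in> L2v {c<..<d}" and \<psi>: "\<psi> \<in> L2 {a<..<b}"
  shows "L2_inner {a<..<b} (b2 {c<..<d} h m) \<psi> = L2v_inner {c<..<d} m (b2_adj {a<..<b} h \<psi>)"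
proof -
  define f g p where "f = ext0 {c<..<d} (fst m)" and "g = ext0 {c<..<d} (snd m)" and "p = ext0 {a<..<b} \<psi>"
  have int: "integrable lborel f" "integrable lborel g" "integrable lborel p"
    using m \<psi> by (auto simp: f_def g_def p_def L2v_def intro!: ext0_integrable)
  let ?R = "\<lambda>u. Re (deriv_kernel h u)" and ?I = "\<lambda>u. Im (deriv_kernel h u)"
  note R = Re_Im_deriv_kernel(1,2)[OF h] and I = Re_Im_deriv_kernel(3,4)[OF h]
  have bp: "\<exists>B. \<forall>x. \<bar>convol \<kappa> q x\<bar> \<le> B"
    if "continuous_on UNIV \<kappa>" "\<And>u. \<bar>\<kappa> u\<bar> \<le> 1 / (pi * h\<^sup>2)" "integrable lborel q" for \<kappa> q
  proof -
    have "\<bar>convol \<kappa> q x\<bar> \<le> (LINT t|lborel. 1 / (pi * h\<^sup>2) * \<bar>q t\<bar>)" for x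
      unfolding convol_def real_norm_def[symmetric]
    proof (rule Bochner_Integration.integral_norm_bound_integral)
      show "norm (\<kappa> (x - t) * q t) \<le> 1 / (pi * h\<^sup>2) * norm (q t)" for t
        unfolding norm_mult using that(2) by (intro mult_right_mono) auto
    qed (use that in \<open>auto intro: convol_integrable\<close>)
    then show ?thesis by blast
  qed
  have intp: "integrable lborel (\<lambda>x. convol \<kappa> q x * p x)"
    if \<kappa>: "continuous_on UNIV \<kappa>" "\<And>u. \<bar>\<kappa> u\<bar> \<le> 1 / (pi * h\<^sup>2)" and q: "integrable lborel q" for \<kappa> q
  proof -
    obtain B where "\<forall>x. \<bar>convol \<kappa> q x\<bar> \<le> B" using bp[OF \<kappa> q] by blast
    then have "integrable lborel (\<lambda>x. p x * convol \<kappa> q x)"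
      using convol_continuous[OF \<kappa> q]
      by (intro integrable_mult_bounded[OF int(3)] borel_measurable_continuous_onI) auto
    then show ?thesis by (simp add: mult.commute)
  qed
  have "L2_inner {a<..<b} (b2 {c<..<d} h m) \<psi> = (LINT x|lborel. convol ?I g x * p x - convol ?R f x * p x)"
    by (simp add: L2_inner_ext0 b2_eq[OF h m] f_def g_def p_def left_diff_distrib)
  also have "\<dots> = (LINT x|lborel. convol ?I g x * p x) - (LINT x|lborel. convol ?R f x * p x)"
    using intp[OF I int(2)] intp[OF R int(1)] by (rule Bochner_Integration.integral_diff)
  also have "(LINT x|lborel. convol ?I g x * p x) = (LINT t|lborel. g t * convol ?I p t)"
    unfolding convol_adjoint[OF I int(2,3)] by (simp add: deriv_kernel_minus[OF h])
  also have "(LINT x|lborel. convol ?R f x * p x) = - (LINT t|lborel. f t * convol ?R p t)"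
    unfolding convol_adjoint[OF R int(1,3)] by (simp add: deriv_kernel_minus[OF h] convol_def)
  finally show ?thesis
    by (simp add: L2v_inner_def b2_adj_eq[OF h \<psi>] L2_inner_ext0_left f_def g_def p_def)
qed

section \<open>Injectivity of \<open>b2\<close>\<close>

lemma open_AE_zero_imp_zero:
  fixes u :: "real \<Rightarrow> real"
  assumes u: "continuous_on UNIV u" and K: "open K" and ae: "eq_ae K u (\<lambda>_. 0)" and x: "x \<in> K"
  shows "u x = 0"
proof (rule ccontr)
  assume "u x \<noteq> 0"
  define W where "W = K \<inter> u -` (- {0})"
  have "open (u -` (- {0}))" using u by (intro open_vimage) auto
  then have W: "open W" "W \<noteq> {}" using K x \<open>u x \<noteq> 0\<close> by (auto simp: W_def)
  have "AE y in lborel. y \<notin> W"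
    using ae unfolding eq_ae_def by (rule eventually_mono) (auto simp: W_def)
  then have "W \<in> null_sets lborel" using W(1) by (simp add: AE_iff_null_sets)
  then have "negligible W" by (simp add: negligible_iff_null_sets null_sets_completionI)
  then show False using W open_not_negligible by blast
qed

lemma b2_injective:
  assumes h: "h > 0" and m: "m \<in> L2v {c<..<d}" and "a < b"
    and zero: "\<And>x. x \<in> {a<..<b} \<Longrightarrow> b2 {c<..<d} h m x = 0"
  shows "eq_aev {c<..<d} m (\<lambda>_. 0, \<lambda>_. 0)"
proof -
  define f g where "f = ext0 {c<..<d} (fst m)" and "g = ext0 {c<..<d} (snd m)"
  have f: "integrable lborel f" and g: "integrable lborel g"
    using m by (auto simp: f_def g_def L2v_def intro!: ext0_integrable)
  define \<mu> where "\<mu> t = complex_of_real (f t) + \<i> * complex_of_real (g t)" for t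
  have \<mu>: "integrable lborel \<mu>"
    unfolding \<mu>_def using f g by (intro Bochner_Integration.integrable_add integrable_mult_right) auto
  \<comment> \<open>The real part of \<open>deriv_kernel\<close> times \<open>\<mu>\<close> combines
    f and g exactly as - \<open>b2\<close> does. Pulling out the factor - \<i> / pi turns this real
    part into the imaginary part of J divided by pi.\<close>
  have Im0: "Im (LINT t|lborel. \<mu> t / (of_real x + \<i> * of_real h - of_real t)\<^sup>2) = 0" if x: "x \<in> {a<..<b}" for x
  proof -
    define J where "J = (LINT t|lborel. \<mu> t / (of_real x + \<i> * of_real h - of_real t)\<^sup>2)"
    have kernel: "(- (\<i> / of_real pi)) * (\<mu> t / (of_real x + \<i> * of_real h - of_real t)\<^sup>2) = deriv_kernel h (x - t) * \<mu> t" for t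
      by (simp add: deriv_kernel_def algebra_simps)
    have int: "integrable lborel (\<lambda>t. deriv_kernel h (x - t) * \<mu> t)"
      unfolding kernel[symmetric] using h by (intro integrable_mult_right cauchy_kernel_integrable[OF \<mu>]) simp
    have "(- (\<i> / of_real pi)) * J = (LINT t|lborel. deriv_kernel h (x - t) * \<mu> t)"
      by (simp only: J_def flip: kernel integral_mult_right_zero)
    then have "Re ((- (\<i> / of_real pi)) * J) = (LINT t|lborel. Re (deriv_kernel h (x - t) * \<mu> t))"
      by (simp only: Bochner_Integration.integral_Re[OF int])
    also have "\<dots> = (LINT t|lborel. Re (deriv_kernel h (x - t)) * f t - Im (deriv_kernel h (x - t)) * g t)"
      by (simp add: \<mu>_def)
    also have "\<dots> = convol (\<lambda>u. Re (deriv_kernel h u)) f x - convol (\<lambda>u. Im (deriv_kernel h u)) g x"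
      unfolding convol_def
      by (rule Bochner_Integration.integral_diff;
          rule convol_integrable[OF _ _ f] convol_integrable[OF _ _ g]; rule Re_Im_deriv_kernel[OF h])
    also have "\<dots> = 0" using zero[OF x] by (simp add: b2_eq[OF h m] f_def g_def)
    finally show ?thesis by (simp add: J_def[symmetric] Re_divide)
  qed
  have ct: "cauchy_transform \<mu> z = 0" if "Im z > 0" for z
    using cauchy_transform_zero_if_Im_deriv_zero[OF \<mu> h \<open>a < b\<close> Im0 that] by simp
  have mom: "(LINT t|lborel. \<mu> t * of_real t ^ n) = 0" for n
    by (rule moments_zero_if_cauchy_transform_zero[OF \<mu> _ ct, where R = "max \<bar>c\<bar> \<bar>d\<bar>"])
      (auto simp: \<mu>_def f_def g_def ext0_def split: if_splits)
  have int: "integrable lborel (\<lambda>t. \<mu> t * of_real t ^ n)" for n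
  proof -
    have "integrable lborel (\<lambda>t. \<mu> t * (of_real (max c (min d t)) ^ n))"
    proof (rule integrable_mult_bounded[OF \<mu>])
      show "norm ((of_real (max c (min d t)) :: complex) ^ n) \<le> (max \<bar>c\<bar> \<bar>d\<bar>) ^ n" for t
        unfolding norm_power by (intro power_mono) auto
    qed measurable
    moreover have "\<mu> t * (of_real (max c (min d t)) ^ n) = \<mu> t * of_real t ^ n" for t
      by (auto simp: \<mu>_def f_def g_def ext0_def max_def min_def)
    ultimately show ?thesis by simp
  qed
  have "(LINT t|lborel. Re (\<mu> t * of_real t ^ n)) = 0" "(LINT t|lborel. Im (\<mu> t * of_real t ^ n)) = 0" for n
    unfolding Bochner_Integration.integral_Re[OF int] Bochner_Integration.integral_Im[OF int] mom by simp_all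
  then have "(LINT t|lborel. f t * t ^ n) = 0" "(LINT t|lborel. g t * t ^ n) = 0" for n
    by (simp_all add: \<mu>_def flip: of_real_power)
  moreover have "(LINT t:{c<..<d}|lborel. q t * t ^ n) = (LINT t|lborel. ext0 {c<..<d} q t * t ^ n)" for q n
    unfolding set_lebesgue_integral_def
    by (intro Bochner_Integration.integral_cong) (auto simp: ext0_def indicator_def)
  ultimately have "(LINT t:{c<..<d}|lborel. fst m t * t ^ n) = 0" "(LINT t:{c<..<d}|lborel. snd m t * t ^ n) = 0" for n
    by (simp_all add: f_def g_def)
  then show ?thesis
    using m unfolding eq_aev_def eq_ae_def fst_conv snd_conv
    by (intro conjI AE_zero_if_moments_zero L2_set_integrable) (auto simp: L2v_def)
qed

section \<open>Intervals and one-sided perturbations\<close>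

lemma bounded_open_interval_eq:
  fixes K :: "real set"
  assumes "open K" "is_interval K" "bounded K" "K \<noteq> {}"
  obtains a b where "a < b" "K = {a<..<b}"
proof -
  have bdd: "bdd_below K" "bdd_above K"
    using assms(3) by (auto intro: bounded_imp_bdd_below bounded_imp_bdd_above)
  have eq: "K = {Inf K<..<Sup K}"
  proof
    show "K \<subseteq> {Inf K<..<Sup K}"
    proof
      fix x assume x: "x \<in> K"
      then obtain e where e: "e > 0" "ball x e \<subseteq> K" using assms(1) open_contains_ball by blast
      have "x - e / 2 \<in> K" "x + e / 2 \<in> K" using e by (auto simp: subset_iff dist_real_def)
      then show "x \<in> {Inf K<..<Sup K}"
        using cInf_lower[OF _ bdd(1)] cSup_upper[OF _ bdd(2)] e(1) by fastforce
    qed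
    show "{Inf K<..<Sup K} \<subseteq> K"
    proof
      fix x assume "x \<in> {Inf K<..<Sup K}"
      then obtain y z where "y \<in> K" "z \<in> K" "y < x" "x < z"
        using cInf_less_iff[OF assms(4) bdd(1)] less_cSup_iff[OF assms(4) bdd(2)] by auto
      then show "x \<in> K" using assms(2) unfolding is_interval_1 by (meson less_imp_le)
    qed
  qed
  then have "Inf K < Sup K" using assms(4) by (metis greaterThanLessThan_empty_iff not_less)
  then show ?thesis using that eq by blast
qed

text \<open>The quadratic is the squared norm of a perturbed minimizer. Either slack in the
  constraint or a decreasing linear term keeps it feasible for small t > 0, whatever the sign of
  N.\<close>

lemma eventually_quadratic_le:
  fixes M0 M1 c N :: real
  assumes "M0 < M1 \<or> (M0 \<le> M1 \<and> c < 0)"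
  shows "\<forall>\<^sub>F t in at_right 0. M0 + 2 * t * c + t\<^sup>2 * N \<le> M1"
  using assms
proof
  assume "M0 < M1"
  have "((\<lambda>t. M0 + 2 * t * c + t\<^sup>2 * N) \<longlongrightarrow> M0 + 2 * 0 * c + 0\<^sup>2 * N) (at_right 0)"
    by (intro tendsto_intros)
  then have "\<forall>\<^sub>F t in at_right 0. M0 + 2 * t * c + t\<^sup>2 * N < M1"
    using \<open>M0 < M1\<close> by (auto dest: order_tendstoD(2))
  then show ?thesis by (rule eventually_mono) simp
next
  assume *: "M0 \<le> M1 \<and> c < 0"
  have "((\<lambda>t. 2 * c + t * N) \<longlongrightarrow> 2 * c + 0 * N) (at_right 0)"
    by (intro tendsto_intros)
  then have "\<forall>\<^sub>F t in at_right 0. 2 * c + t * N < 0"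
    using order_tendstoD(2)[of _ "2 * c + 0 * N" _ 0] * by simp
  moreover have "\<forall>\<^sub>F t in at_right (0::real). 0 < t" by (rule eventually_at_right_less)
  ultimately show ?thesis
  proof eventually_elim
    case (elim t)
    then have "t * (2 * c + t * N) \<le> 0" by (intro mult_nonneg_nonpos) auto
    then show ?case using * by (simp add: power2_eq_square algebra_simps)
  qed
qed

text \<open>Divide by t > 0 and let t tend to 0.\<close>

lemma linear_coeff_nonneg:
  fixes L N :: real
  assumes "\<forall>\<^sub>F t in at_right 0. 0 \<le> 2 * t * L + t\<^sup>2 * N"
  shows "0 \<le> L"
proof -
  have "((\<lambda>t. 2 * L + t * N) \<longlongrightarrow> 2 * L + 0 * N) (at_right 0)"
    by (intro tendsto_intros)
  moreover have "\<forall>\<^sub>F t in at_right 0. 0 \<le> 2 * L + t * N"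
    using assms eventually_at_right_less[of "0::real"]
  proof eventually_elim
    case (elim t)
    then have "0 \<le> t * (2 * L + t * N)" by (simp add: power2_eq_square algebra_simps)
    then show ?case using elim(2) by (simp add: zero_le_mult_iff)
  qed
  ultimately have "0 \<le> 2 * L + 0 * N" by (intro tendsto_lowerbound) auto
  then show ?thesis by simp
qed

section \<open>The constrained minimization problem\<close>

lemma L2v_inner_lin_right:
  assumes "f \<in> L2v A" "g \<in> L2v A" "k \<in> L2v A"
  shows "L2v_inner A k (\<lambda>x. s * fst f x + t * fst g x, \<lambda>x. s * snd f x + t * snd g x)
    = s * L2v_inner A k f + t * L2v_inner A k g"
  using assms by (simp add: L2v_inner_def L2v_def mem_Times_iff L2_inner_lin_right algebra_simps)

lemma L2v_inner_diffv:
  assumes "f \<in> L2v A" "g \<in> L2v A" "k \<in> L2v A"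
  shows "L2v_inner A (diffv f g) k = L2v_inner A f k - L2v_inner A g k"
  using assms L2_inner_lin_left[of "fst f" A "fst g" "fst k" 1 "-1"]
    L2_inner_lin_left[of "snd f" A "snd g" "snd k" 1 "-1"]
  by (simp add: L2v_inner_def L2v_def mem_Times_iff diffv_def)

lemma diffv_L2v: "f \<in> L2v A \<Longrightarrow> g \<in> L2v A \<Longrightarrow> diffv f g \<in> L2v A"
  by (simp add: L2v_def mem_Times_iff diffv_def L2_diff)

lemma b2_adj_lin:
  assumes h: "h > 0" and \<phi>: "\<phi> \<in> L2 {a<..<b}" and \<psi>: "\<psi> \<in> L2 {a<..<b}"
  shows "b2_adj {a<..<b} h (\<lambda>x. s * \<phi> x + t * \<psi> x)
    = (\<lambda>x. s * fst (b2_adj {a<..<b} h \<phi>) x + t * fst (b2_adj {a<..<b} h \<psi>) x,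
       \<lambda>x. s * snd (b2_adj {a<..<b} h \<phi>) x + t * snd (b2_adj {a<..<b} h \<psi>) x)"
  unfolding b2_adj_eq[OF h \<phi>] b2_adj_eq[OF h \<psi>] b2_adj_eq[OF h L2_lin[OF \<phi> \<psi>]] ext0_lin
    convol_lin[OF Re_Im_deriv_kernel(1,2)[OF h] ext0_integrable[OF \<phi>] ext0_integrable[OF \<psi>], abs_def]
    convol_lin[OF Re_Im_deriv_kernel(3,4)[OF h] ext0_integrable[OF \<phi>] ext0_integrable[OF \<psi>], abs_def]
  by simp

lemma L2v_norm_square: "(L2v_norm A f)\<^sup>2 = L2v_inner A f f"
  by (simp add: L2v_norm_def L2v_inner_def L2_inner_nonneg)

lemma L2v_norm_square_add:
  assumes "f \<in> L2v A" "g \<in> L2v A"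
  shows "(L2v_norm A (\<lambda>x. fst f x + t * fst g x, \<lambda>x. snd f x + t * snd g x))\<^sup>2
    = (L2v_norm A f)\<^sup>2 + 2 * t * L2v_inner A f g + t\<^sup>2 * L2v_inner A g g"
  using assms unfolding L2v_norm_square
  by (simp add: L2v_inner_def L2v_def mem_Times_iff L2_inner_square algebra_simps)

lemma W012_norm_square: "(W012_norm K \<phi>)\<^sup>2 = L2_inner K (weak_deriv K \<phi>) (weak_deriv K \<phi>)"
  by (simp add: W012_norm_def L2_norm_def L2_inner_nonneg)

lemma W012_norm_nonneg: "0 \<le> W012_norm K \<phi>"
  by (simp add: W012_norm_def L2_norm_def L2_inner_nonneg)

lemma weak_deriv_inner_lin:
  assumes \<phi>: "\<phi> \<in> W012 {a<..<b}" and \<psi>: "\<psi> \<in> W012 {a<..<b}" and g: "g \<in> L2 {a<..<b}"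
  shows "L2_inner {a<..<b} g (weak_deriv {a<..<b} (\<lambda>x. s * \<phi> x + t * \<psi> x))
    = s * L2_inner {a<..<b} g (weak_deriv {a<..<b} \<phi>) + t * L2_inner {a<..<b} g (weak_deriv {a<..<b} \<psi>)"
proof -
  have "L2_inner {a<..<b} g (weak_deriv {a<..<b} (\<lambda>x. s * \<phi> x + t * \<psi> x))
    = L2_inner {a<..<b} g (\<lambda>x. s * weak_deriv {a<..<b} \<phi> x + t * weak_deriv {a<..<b} \<psi> x)"
    using assms
    by (intro L2_inner_cong_ae weak_deriv_lin W012_lin weak_deriv_W012 L2_lin) (auto simp: eq_ae_def)
  then show ?thesis
    using assms by (simp add: L2_inner_lin_right weak_deriv_W012)
qed

lemma W012_norm_square_add:
  assumes \<phi>: "\<phi> \<in> W012 {a<..<b}" and \<psi>: "\<psi> \<in> W012 {a<..<b}"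
  shows "(W012_norm {a<..<b} (\<lambda>x. \<phi> x + t * \<psi> x))\<^sup>2 = (W012_norm {a<..<b} \<phi>)\<^sup>2
    + 2 * t * L2_inner {a<..<b} (weak_deriv {a<..<b} \<phi>) (weak_deriv {a<..<b} \<psi>)
    + t\<^sup>2 * L2_inner {a<..<b} (weak_deriv {a<..<b} \<psi>) (weak_deriv {a<..<b} \<psi>)"
proof -
  let ?K = "{a<..<b}"
  let ?w = "\<lambda>x. weak_deriv ?K \<phi> x + t * weak_deriv ?K \<psi> x"
  have w: "?w \<in> L2 ?K"
    using L2_lin[OF weak_deriv_W012(1)[OF \<phi>] weak_deriv_W012(1)[OF \<psi>], of 1 t] by simp
  have W: "(\<lambda>x. \<phi> x + t * \<psi> x) \<in> W012 ?K" using W012_lin[OF assms, of 1 t] by simp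
  have "eq_ae ?K (weak_deriv ?K (\<lambda>x. \<phi> x + t * \<psi> x)) ?w"
    using weak_deriv_lin[OF assms, of 1 t] by simp
  then have "(W012_norm ?K (\<lambda>x. \<phi> x + t * \<psi> x))\<^sup>2 = L2_inner ?K ?w ?w"
    unfolding W012_norm_square using w weak_deriv_W012(1)[OF W] by (intro L2_inner_cong_ae)
  also have "\<dots> = L2_inner ?K (weak_deriv ?K \<phi>) (weak_deriv ?K \<phi>)
    + 2 * t * L2_inner ?K (weak_deriv ?K \<phi>) (weak_deriv ?K \<psi>)
    + t\<^sup>2 * L2_inner ?K (weak_deriv ?K \<psi>) (weak_deriv ?K \<psi>)"
    by (rule L2_inner_square[OF weak_deriv_W012(1)[OF \<phi>] weak_deriv_W012(1)[OF \<psi>]])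
  finally show ?thesis by (simp add: W012_norm_square)
qed

text \<open>Squaring turns constraint and objective into quadratics in t, whose linear coefficients
  are twice the two inner products of interest. \<open>dir\<close> is what makes
  \<open>\<phi> + t \<psi>\<close> feasible for small t > 0; minimality then bounds the change of
  the objective from below.\<close>

lemma minimizer_directional_deriv_nonneg:
  assumes h: "h > 0" and e: "e \<in> L2v {c<..<d}"
    and min: "constrained_minimizer {c<..<d} {a<..<b} h M e \<phi>" and \<psi>: "\<psi> \<in> W012 {a<..<b}"
    and dir: "W012_norm {a<..<b} \<phi> < M \<or>
      L2_inner {a<..<b} (weak_deriv {a<..<b} \<phi>) (weak_deriv {a<..<b} \<psi>) < 0"
  shows "0 \<le> L2v_inner {c<..<d} (diffv (b2_adj {a<..<b} h \<phi>) e) (b2_adj {a<..<b} h \<psi>)"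
proof -
  let ?K = "{a<..<b}" and ?S = "{c<..<d}"
  define r where "r = diffv (b2_adj ?K h \<phi>) e"
  have \<phi>: "\<phi> \<in> W012 ?K" and le: "W012_norm ?K \<phi> \<le> M"
    and opt: "\<And>\<phi>'. \<phi>' \<in> W012 ?K \<Longrightarrow> W012_norm ?K \<phi>' \<le> M \<Longrightarrow>
      L2v_norm ?S r \<le> L2v_norm ?S (diffv (b2_adj ?K h \<phi>') e)"
    using min by (auto simp: constrained_minimizer_def r_def)
  have M: "0 \<le> M" using le W012_norm_nonneg order_trans by blast
  have adj: "b2_adj ?K h \<phi> \<in> L2v ?S" "b2_adj ?K h \<psi> \<in> L2v ?S"
    using h \<phi> \<psi> by (auto intro: b2_adj_L2v W012_L2)
  have r: "r \<in> L2v ?S" unfolding r_def using adj e by (intro diffv_L2v)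
  have "(W012_norm ?K \<phi>)\<^sup>2 < M\<^sup>2 \<or> (W012_norm ?K \<phi>)\<^sup>2 \<le> M\<^sup>2 \<and>
      L2_inner ?K (weak_deriv ?K \<phi>) (weak_deriv ?K \<psi>) < 0"
    using dir le M by (auto intro: power_strict_mono power_mono W012_norm_nonneg)
  then have "\<forall>\<^sub>F t in at_right 0. (W012_norm ?K \<phi>)\<^sup>2
      + 2 * t * L2_inner ?K (weak_deriv ?K \<phi>) (weak_deriv ?K \<psi>)
      + t\<^sup>2 * L2_inner ?K (weak_deriv ?K \<psi>) (weak_deriv ?K \<psi>) \<le> M\<^sup>2"
    by (rule eventually_quadratic_le)
  then have "\<forall>\<^sub>F t in at_right 0. 0 \<le> 2 * t * L2v_inner ?S r (b2_adj ?K h \<psi>)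
      + t\<^sup>2 * L2v_inner ?S (b2_adj ?K h \<psi>) (b2_adj ?K h \<psi>)"
  proof eventually_elim
    case (elim t)
    then have "W012_norm ?K (\<lambda>x. \<phi> x + t * \<psi> x) \<le> M"
      by (intro power2_le_imp_le[OF _ M]) (simp only: W012_norm_square_add[OF \<phi> \<psi>])
    moreover have "(\<lambda>x. \<phi> x + t * \<psi> x) \<in> W012 ?K" using W012_lin[OF \<phi> \<psi>, of 1 t] by simp
    ultimately have "L2v_norm ?S r \<le> L2v_norm ?S (diffv (b2_adj ?K h (\<lambda>x. \<phi> x + t * \<psi> x)) e)"
      by (intro opt)
    also have "diffv (b2_adj ?K h (\<lambda>x. \<phi> x + t * \<psi> x)) e
        = (\<lambda>x. fst r x + t * fst (b2_adj ?K h \<psi>) x, \<lambda>x. snd r x + t * snd (b2_adj ?K h \<psi>) x)"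
      using b2_adj_lin[OF h W012_L2[OF \<phi>] W012_L2[OF \<psi>], of 1 t]
      by (simp add: diffv_def r_def algebra_simps)
    finally have "(L2v_norm ?S r)\<^sup>2 \<le> (L2v_norm ?S (\<lambda>x. fst r x + t * fst (b2_adj ?K h \<psi>) x, \<lambda>x. snd r x + t * snd (b2_adj ?K h \<psi>) x))\<^sup>2"
      by (intro power_mono) (simp_all add: L2v_norm_def L2v_inner_def L2_inner_nonneg)
    then show ?case
      unfolding L2v_norm_square_add[OF r adj(2)] by simp
  qed
  then show ?thesis unfolding r_def by (rule linear_coeff_nonneg)
qed

text \<open>By adjointness, b2 r is orthogonal to every test function on K, hence zero almost
  everywhere there. Its continuity improves this to every point, as \<open>b2_injective\<close>
  requires.\<close>

lemma residual_zero_if_orthogonal: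
  assumes h: "h > 0" and "a < b" and r: "r \<in> L2v {c<..<d}"
    and orth: "\<And>\<psi>. \<psi> \<in> W012 {a<..<b} \<Longrightarrow> L2v_inner {c<..<d} r (b2_adj {a<..<b} h \<psi>) = 0"
  shows "eq_aev {c<..<d} r (\<lambda>_. 0, \<lambda>_. 0)"
proof (rule b2_injective[OF h r \<open>a < b\<close>])
  fix x assume x: "x \<in> {a<..<b}"
  note cont = b2_continuous[OF h r]
  have "eq_ae {a<..<b} (b2 {c<..<d} h r) (\<lambda>_. 0)"
  proof (rule eq_ae_if_test_function_integrals_eq)
    show "b2 {c<..<d} h r \<in> L2 {a<..<b}" "(\<lambda>_. 0) \<in> L2 {a<..<b}"
      using cont by (auto intro: continuous_L2)
    fix \<eta> assume \<eta>: "\<eta> \<in> test_functions {a<..<b}"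
    then have "\<eta> \<in> W012 {a<..<b}" using \<open>a < b\<close> by (rule test_function_W012)
    then have "L2_inner {a<..<b} (b2 {c<..<d} h r) \<eta> = 0"
      using b2_adjoint[OF h r W012_L2] orth by simp
    then show "L2_inner {a<..<b} (b2 {c<..<d} h r) \<eta> = L2_inner {a<..<b} (\<lambda>_. 0) \<eta>"
      by (simp add: L2_inner_def)
  qed
  with cont show "b2 {c<..<d} h r x = 0"
    by (rule open_AE_zero_imp_zero[OF _ open_greaterThanLessThan _ x])
qed

(* For M = 0 the minimizer is 0 and the weak equation would force b2 e = 0, hence e = 0
   (b2 is injective), contradicting e_notin; so the equation is claimed only for M > 0. *)
theorem mainTheorem5:
  fixes S K :: "real set" and h M :: real and e :: field2 and \<phi>\<^sub>o :: "real \<Rightarrow> real"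
  assumes S: "open S" "is_interval S" "bounded S" "S \<noteq> {}"
    and K: "open K" "is_interval K" "bounded K" "K \<noteq> {}"
    and h: "h > 0"
    and M: "M \<ge> 0"
    and e: "e \<in> L2v S"
    and e_notin: "\<not> (\<exists>\<phi> \<in> W012 K. eq_aev S (b2_adj K h \<phi>) e)"
    and minimizer: "constrained_minimizer S K h M e \<phi>\<^sub>o"
  shows "(M > 0 \<longrightarrow> (\<exists>\<gamma><0. \<forall>\<psi> \<in> W012 K.
            L2_inner K (b2 S h (b2_adj K h \<phi>\<^sub>o)) \<psi> - L2_inner K (b2 S h e) \<psi>
              = \<gamma> * L2_inner K (weak_deriv K \<phi>\<^sub>o) (weak_deriv K \<psi>)))
         \<and> W012_norm K \<phi>\<^sub>o = M"
proof -
  obtain a b where "a < b" and K_eq: "K = {a<..<b}" using bounded_open_interval_eq[OF K] .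
  obtain c d where S_eq: "S = {c<..<d}" using bounded_open_interval_eq[OF S] .
  define r where "r = diffv (b2_adj K h \<phi>\<^sub>o) e"
  define L where "L \<psi> = L2v_inner S r (b2_adj K h \<psi>)" for \<psi>
  define G where "G \<psi> = L2_inner K (weak_deriv K \<phi>\<^sub>o) (weak_deriv K \<psi>)" for \<psi>
  have \<phi>: "\<phi>\<^sub>o \<in> W012 K" and le: "W012_norm K \<phi>\<^sub>o \<le> M"
    using minimizer by (auto simp: constrained_minimizer_def)
  have adj: "b2_adj K h \<psi> \<in> L2v S" if "\<psi> \<in> W012 K" for \<psi>
    using that h unfolding K_eq S_eq by (intro b2_adj_L2v W012_L2)
  have r: "r \<in> L2v S" unfolding r_def by (intro diffv_L2v adj \<phi> e)
  have lin: "(\<lambda>x. s * \<psi> x + t * \<phi>\<^sub>o x) \<in> W012 K"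
    "L (\<lambda>x. s * \<psi> x + t * \<phi>\<^sub>o x) = s * L \<psi> + t * L \<phi>\<^sub>o"
    "G (\<lambda>x. s * \<psi> x + t * \<phi>\<^sub>o x) = s * G \<psi> + t * G \<phi>\<^sub>o"
    if \<psi>: "\<psi> \<in> W012 K" for s t \<psi>
  proof -
    show "(\<lambda>x. s * \<psi> x + t * \<phi>\<^sub>o x) \<in> W012 K"
      using \<psi> \<phi> unfolding K_eq by (rule W012_lin)
    have "b2_adj K h (\<lambda>x. s * \<psi> x + t * \<phi>\<^sub>o x)
      = (\<lambda>x. s * fst (b2_adj K h \<psi>) x + t * fst (b2_adj K h \<phi>\<^sub>o) x,
         \<lambda>x. s * snd (b2_adj K h \<psi>) x + t * snd (b2_adj K h \<phi>\<^sub>o) x)"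
      using h \<psi> \<phi> unfolding K_eq by (intro b2_adj_lin W012_L2)
    then show "L (\<lambda>x. s * \<psi> x + t * \<phi>\<^sub>o x) = s * L \<psi> + t * L \<phi>\<^sub>o"
      unfolding L_def by (simp only: L2v_inner_lin_right[OF adj[OF \<psi>] adj[OF \<phi>] r])
    show "G (\<lambda>x. s * \<psi> x + t * \<phi>\<^sub>o x) = s * G \<psi> + t * G \<phi>\<^sub>o"
      using \<psi> \<phi> unfolding G_def K_eq by (intro weak_deriv_inner_lin weak_deriv_W012)
  qed
  have nonneg: "0 \<le> L \<psi>" if "\<psi> \<in> W012 K" "W012_norm K \<phi>\<^sub>o < M \<or> G \<psi> < 0" for \<psi>
    using minimizer_directional_deriv_nonneg[OF h e[unfolded S_eq] minimizer[unfolded S_eq K_eq], of \<psi>] that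
    by (simp add: L_def G_def r_def S_eq K_eq)
  \<comment> \<open>If L vanished identically, the residual would be 0 and e would be the image of
    \<open>\<phi>\<^sub>o\<close>, against \<open>e_notin\<close>. This excludes both an inactive
    constraint and \<gamma> = 0.\<close>
  have not_orth: "\<exists>\<psi>\<in>W012 K. L \<psi> \<noteq> 0"
  proof (rule ccontr)
    assume "\<not> ?thesis"
    then have "eq_aev S r (\<lambda>_. 0, \<lambda>_. 0)"
      using residual_zero_if_orthogonal[OF h \<open>a < b\<close> r[unfolded S_eq]] by (simp add: L_def S_eq K_eq)
    then have "eq_aev S (b2_adj K h \<phi>\<^sub>o) e"
      by (simp add: eq_aev_def eq_ae_def r_def diffv_def)
    then show False using e_notin \<phi> by blast
  qed
  have norm_eq: "W012_norm K \<phi>\<^sub>o = M"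
  proof (rule ccontr)
    assume "W012_norm K \<phi>\<^sub>o \<noteq> M"
    then have less: "W012_norm K \<phi>\<^sub>o < M" using le by simp
    \<comment> \<open>With slack every direction is admissible, so \<open>nonneg\<close> applies to
      \<open>\<psi>\<close> and to its negative, obtained from \<open>lin\<close> with coefficients
      - 1 and 0.\<close>
    have "L \<psi> = 0" if \<psi>: "\<psi> \<in> W012 K" for \<psi>
      using nonneg[OF \<psi>] nonneg[OF lin(1)[OF \<psi>, of "- 1" 0]] lin(2)[OF \<psi>, of "- 1" 0] less by simp
    then show False using not_orth by blast
  qed
  have "\<exists>\<gamma><0. \<forall>\<psi>\<in>W012 K. L \<psi> = \<gamma> * G \<psi>" if "M > 0"
  proof -
    have G\<phi>: "G \<phi>\<^sub>o = M\<^sup>2" unfolding G_def W012_norm_square[symmetric] norm_eq ..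
    \<comment> \<open>The constraint is active, so \<open>nonneg\<close> is available only where G
      is strictly negative. The coefficient k is chosen to make G of the corrected direction equal
      to - \<delta> times \<open>M\<^sup>2\<close>; then \<delta> tends to 0. Taking s = 1 and s = -
      1 later gives the two inequalities of an equality.\<close>
    have ker: "s * L \<psi> \<ge> s * G \<psi> / M\<^sup>2 * L \<phi>\<^sub>o" if \<psi>: "\<psi> \<in> W012 K" for s \<psi>
    proof -
      have "0 \<le> s * L \<psi> - (s * G \<psi> / M\<^sup>2 + \<delta>) * L \<phi>\<^sub>o" if "\<delta> > 0" for \<delta>
      proof -
        define k where "k = - (s * G \<psi> / M\<^sup>2 + \<delta>)"
        have "G (\<lambda>x. s * \<psi> x + k * \<phi>\<^sub>o x) = - \<delta> * M\<^sup>2"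
          unfolding lin(3)[OF \<psi>] G\<phi> k_def using \<open>M > 0\<close> by (simp add: field_simps)
        also have "\<dots> < 0" using \<open>M > 0\<close> that by simp
        finally have "0 \<le> L (\<lambda>x. s * \<psi> x + k * \<phi>\<^sub>o x)" by (intro nonneg lin(1) \<psi> disjI2)
        then show ?thesis unfolding lin(2)[OF \<psi>] by (simp add: k_def algebra_simps)
      qed
      note pos = this
      have "((\<lambda>\<delta>. s * L \<psi> - (s * G \<psi> / M\<^sup>2 + \<delta>) * L \<phi>\<^sub>o) \<longlongrightarrow> s * L \<psi> - (s * G \<psi> / M\<^sup>2 + 0) * L \<phi>\<^sub>o) (at_right 0)"
        by (intro tendsto_intros)
      moreover have "\<forall>\<^sub>F \<delta> in at_right 0. 0 \<le> s * L \<psi> - (s * G \<psi> / M\<^sup>2 + \<delta>) * L \<phi>\<^sub>o"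
        using eventually_at_right_less by (rule eventually_mono) (rule pos)
      ultimately have "0 \<le> s * L \<psi> - (s * G \<psi> / M\<^sup>2 + 0) * L \<phi>\<^sub>o"
        by (intro tendsto_lowerbound) auto
      then show ?thesis by simp
    qed
    \<comment> \<open>Forced by testing with \<open>\<phi>\<^sub>o\<close> itself, where G equals
      \<open>M\<^sup>2\<close>.\<close>
    define \<gamma> where "\<gamma> = L \<phi>\<^sub>o / M\<^sup>2"
    have eq: "L \<psi> = \<gamma> * G \<psi>" if "\<psi> \<in> W012 K" for \<psi>
      using ker[OF that, of 1] ker[OF that, of "- 1"] by (simp add: \<gamma>_def mult.commute)
    \<comment> \<open>The direction is the negative of \<open>\<phi>\<^sub>o\<close>, written in the
      shape that \<open>lin\<close> expects. Moving inwards is feasible, so L at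
      \<open>\<phi>\<^sub>o\<close> is at most 0.\<close>
    have "G (\<lambda>x. 0 * \<phi>\<^sub>o x + (- 1) * \<phi>\<^sub>o x) < 0"
      unfolding lin(3)[OF \<phi>] G\<phi> using \<open>M > 0\<close> by simp
    then have "0 \<le> L (\<lambda>x. 0 * \<phi>\<^sub>o x + (- 1) * \<phi>\<^sub>o x)"
      by (intro nonneg lin(1) \<phi> disjI2)
    then have "L \<phi>\<^sub>o \<le> 0" unfolding lin(2)[OF \<phi>] by simp
    then have "\<gamma> \<le> 0" using \<open>M > 0\<close> by (simp add: \<gamma>_def divide_nonpos_pos)
    moreover have "\<gamma> \<noteq> 0" using not_orth eq by auto
    ultimately show ?thesis using eq by (intro exI[of _ \<gamma>]) auto
  qed
  moreover have "L2_inner K (b2 S h (b2_adj K h \<phi>\<^sub>o)) \<psi> - L2_inner K (b2 S h e) \<psi> = L \<psi>"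
    if \<psi>: "\<psi> \<in> W012 K" for \<psi>
  proof -
    have "L2_inner K (b2 S h m) \<psi> = L2v_inner S m (b2_adj K h \<psi>)" if "m \<in> L2v S" for m
      using h that \<psi> unfolding S_eq K_eq by (intro b2_adjoint W012_L2)
    then show ?thesis
      unfolding L_def r_def by (simp add: adj \<phi> \<psi> e L2v_inner_diffv)
  qed
  ultimately show ?thesis using norm_eq by (simp add: G_def)
qed

end
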